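(* Let $n<\omega$ and let $H=(\mathbb{R}^n,E)$ be an algebraic $k$-hypergraph (for some $2\le k<\omega$). The following are equivalent: (1) There is a finite $m$ such that every complete set $X\subseteq\mathbb{R}^n$ satisfies $|X|<m$. (2) Every complete set $X\subseteq\mathbb{R}^n$ satisfies $|X|<2^{\aleph_0}$. (3) Every infinite $X\subseteq\mathbb{R}^n$ has an independent subset $Y\subseteq X$ with $|Y|=|X|$.
   Context: For $2\le k<\omega$, a $k$-hypergraph is a pair $H=(V,E)$ with $E\subseteq[V]^k$, where $[V]^k$ is the set of $k$-element subsets of $V$. A set $X\subseteq V$ is independent if $[X]^k\cap E=\varnothing$ and complete if $[X]^k\subseteq E$. A $k$-hypergraph $H=(V,E)$ is algebraic if there are $n<\omega$ and a polynomial $p(x_0,\dots,x_{k-1})$ with real coefficients, where each $x_i$ is an $n$-tuple of variables, such that $V=\mathbb{R}^n$ and $E$ is the set of those $\{a_0,\dots,a_{k-1}\}\in[\mathbb{R}^n]^k$ (for some enumeration $a_0,\dots,a_{k-1}$ of its elements) with $p(a_0,\dots,a_{k-1})=0$; $p$ is said to define $H$. *)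

theory Defs
  imports Complex_Main "HOL-Library.Equipollence"
begin

inductive_set poly_fun :: "'v set \<Rightarrow> (('v \<Rightarrow> real) \<Rightarrow> real) set" for S :: "'v set" where
  const: "(\<lambda>x. c) \<in> poly_fun S"
| var: "v \<in> S \<Longrightarrow> (\<lambda>x. x v) \<in> poly_fun S"
| add: "p \<in> poly_fun S \<Longrightarrow> q \<in> poly_fun S \<Longrightarrow> (\<lambda>x. p x + q x) \<in> poly_fun S"
| mult: "p \<in> poly_fun S \<Longrightarrow> q \<in> poly_fun S \<Longrightarrow> (\<lambda>x. p x * q x) \<in> poly_fun S"

text \<open>R^n, represented as real sequences vanishing from index n on (allows n = 0).\<close>
definition Rn :: "nat \<Rightarrow> (nat \<Rightarrow> real) set" where
  "Rn n = {x. \<forall>i\<ge>n. x i = 0}"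

definition ksubsets :: "'a set \<Rightarrow> nat \<Rightarrow> 'a set set" where
  "ksubsets X k = {A. A \<subseteq> X \<and> finite A \<and> card A = k}"

definition poly_edges :: "nat \<Rightarrow> nat \<Rightarrow> ((nat \<times> nat \<Rightarrow> real) \<Rightarrow> real) \<Rightarrow> (nat \<Rightarrow> real) set set" where
  "poly_edges n k p = {e \<in> ksubsets (Rn n) k.
      \<exists>a. bij_betw a {..<k} e \<and> p (\<lambda>(i,j). a i j) = 0}"

definition algebraic_hypergraph :: "nat \<Rightarrow> nat \<Rightarrow> (nat \<Rightarrow> real) set set \<Rightarrow> bool" where
  "algebraic_hypergraph n k E \<longleftrightarrow>
     (\<exists>p \<in> poly_fun ({..<k} \<times> {..<n}). E = poly_edges n k p)"

definition independent :: "nat \<Rightarrow> 'a set set \<Rightarrow> 'a set \<Rightarrow> bool" where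
  "independent k E X \<longleftrightarrow> ksubsets X k \<inter> E = {}"

definition complete :: "nat \<Rightarrow> 'a set set \<Rightarrow> 'a set \<Rightarrow> bool" where
  "complete k E X \<longleftrightarrow> ksubsets X k \<subseteq> E"

end

theory Submission
  imports Defs "HOL-Analysis.Analysis"
begin

text \<open>The product \<open>q\<close> of the defining polynomial over all orders of its arguments is a finite sum of
  products of polynomials in one argument each, so its slices (all arguments but one fixed) span a
  finite-dimensional space. Hence if \<open>q\<close> vanishes on all tuples from a set \<open>A\<close>, it still vanishes on
  all tuples from the set \<open>V \<supseteq> A\<close> of common zeros of the slices vanishing on \<open>A\<close>, which is the zero set
  of one polynomial of degree bounded independently of \<open>A\<close>.

  A real zero set of bounded degree has a bounded number of points or at least continuum many: the zeros
  of \<open>f \<ge> 0\<close> that are not isolated form a perfect set, and each isolated zero persists as a solution of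
  \<open>grad f = a\<close> for all small \<open>a\<close>; for generic \<open>a\<close> these solutions are few, since every coordinate is
  algebraic over \<open>grad f\<close> with a degree that can be bounded by counting dimensions. So if complete sets
  are smaller than the continuum, then \<open>q\<close> does not vanish on \<open>A\<^sup>k\<close> for \<open>A\<close> beyond a bounded size. A
  complete set is such an \<open>A\<close> up to boundedly many points, which bounds complete sets.

  For independent sets, finite dimension allows to shrink \<open>X\<close> to a subset of the same cardinality on
  which every slice vanishes everywhere or on fewer points, and then to choose points greedily. This works
  for regular \<open>|X|\<close>; singular \<open>|X|\<close> is reduced to its cofinality.\<close>

section \<open>Finite-dimensional spaces of functions\<close>

lemma homogeneous_system:
  fixes c :: "'t \<Rightarrow> 'i \<Rightarrow> real"
  assumes "finite T" "finite I" "card T < card I"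
  shows "\<exists>u. (\<exists>i\<in>I. u i \<noteq> 0) \<and> (\<forall>t\<in>T. (\<Sum>i\<in>I. c t i * u i) = 0)"
  using assms
proof (induction T arbitrary: I c rule: finite_induct)
  case empty
  then have "I \<noteq> {}" by auto
  then show ?case by (intro exI[of _ "\<lambda>_. 1"]) auto
next
  case (insert t T)
  show ?case
  proof (cases "\<forall>i\<in>I. c t i = 0")
    case True
    obtain u where "\<exists>i\<in>I. u i \<noteq> 0" "\<forall>s\<in>T. (\<Sum>i\<in>I. c s i * u i) = 0"
      using insert.IH[of I c] insert.prems insert.hyps by auto
    then show ?thesis using True by (intro exI[of _ u]) auto
  next
    case False
    then obtain j where j: "j \<in> I" "c t j \<noteq> 0" by auto
    let ?J = "I - {j}"
    define c' where "c' s i = c s i - c s j * c t i / c t j" for s i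
    have "card T < card ?J" using insert.prems insert.hyps j by simp
    then obtain u where u: "\<exists>i\<in>?J. u i \<noteq> 0" "\<forall>s\<in>T. (\<Sum>i\<in>?J. c' s i * u i) = 0"
      using insert.IH[of ?J c'] insert.prems by auto
    define v where "v i = (if i = j then - (\<Sum>i\<in>?J. c t i * u i) / c t j else u i)" for i
    have sumv: "(\<Sum>i\<in>I. c s i * v i) = (\<Sum>i\<in>?J. c' s i * u i)" for s
    proof -
      have "(\<Sum>i\<in>I. c s i * v i) = c s j * v j + (\<Sum>i\<in>?J. c s i * v i)"
        using j insert.prems by (simp add: sum.remove)
      also have "(\<Sum>i\<in>?J. c s i * v i) = (\<Sum>i\<in>?J. c s i * u i)"
        by (rule sum.cong) (auto simp: v_def)
      also have "c s j * v j = - (\<Sum>i\<in>?J. c s j * c t i / c t j * u i)"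
        by (simp add: v_def sum_distrib_left sum_divide_distrib mult.assoc)
      finally show ?thesis
        by (simp add: c'_def left_diff_distrib sum_subtractf)
    qed
    have "(\<Sum>i\<in>I. c t i * v i) = 0"
      unfolding sumv using j by (simp add: c'_def)
    moreover have "\<exists>i\<in>I. v i \<noteq> 0"
    proof -
      from u(1) obtain i where "i \<in> ?J" "u i \<noteq> 0" by auto
      then show ?thesis by (intro bexI[of _ i]) (auto simp: v_def)
    qed
    ultimately show ?thesis using u(2) sumv by (intro exI[of _ v]) auto
  qed
qed

definition fspan :: "('a \<Rightarrow> real) set \<Rightarrow> ('a \<Rightarrow> real) set" where
  "fspan T = {f. \<exists>c. \<forall>x. f x = (\<Sum>t\<in>T. c t * t x)}"

lemma fspanI: "(\<And>x. f x = (\<Sum>t\<in>T. c t * t x)) \<Longrightarrow> f \<in> fspan T"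
  unfolding fspan_def by blast

lemma fspanE:
  assumes "f \<in> fspan T" obtains c where "\<And>x. f x = (\<Sum>t\<in>T. c t * t x)"
  using assms unfolding fspan_def by blast

lemma fspan_superset:
  assumes "finite T" "f \<in> T" shows "f \<in> fspan T"
  using assms by (intro fspanI[where c = "\<lambda>t. if t = f then 1 else 0"]) (simp add: mult_delta_left)

lemma fspan_zero: "(\<lambda>x. 0) \<in> fspan T"
  by (rule fspanI[where c = "\<lambda>t. 0"]) simp

lemma fspan_add:
  assumes "f \<in> fspan T" "g \<in> fspan T" shows "(\<lambda>x. f x + g x) \<in> fspan T"
proof -
  obtain c where "\<And>x. f x = (\<Sum>t\<in>T. c t * t x)" by (rule fspanE[OF assms(1)]) (rule that)
  moreover obtain d where "\<And>x. g x = (\<Sum>t\<in>T. d t * t x)" by (rule fspanE[OF assms(2)]) (rule that)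
  ultimately show ?thesis
    by (intro fspanI[where c = "\<lambda>t. c t + d t"]) (simp add: distrib_right sum.distrib)
qed

lemma fspan_cmult:
  assumes "f \<in> fspan T" shows "(\<lambda>x. b * f x) \<in> fspan T"
proof -
  obtain c where "\<And>x. f x = (\<Sum>t\<in>T. c t * t x)" by (rule fspanE[OF assms]) (rule that)
  then show ?thesis
    by (intro fspanI[where c = "\<lambda>t. b * c t"]) (simp add: sum_distrib_left mult.assoc)
qed

lemma fspan_sum:
  assumes "\<And>i. i \<in> I \<Longrightarrow> f i \<in> fspan T" shows "(\<lambda>x. \<Sum>i\<in>I. f i x) \<in> fspan T"
  using assms
proof (induction I rule: infinite_finite_induct)
  case (insert i I)
  then show ?case using fspan_add[of "f i" T "\<lambda>x. \<Sum>i\<in>I. f i x"] by simp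
qed (simp_all add: fspan_zero)

lemma fspan_subset_fspan:
  assumes "T \<subseteq> fspan S" shows "fspan T \<subseteq> fspan S"
proof
  fix f assume "f \<in> fspan T"
  then obtain c where c: "\<And>x. f x = (\<Sum>t\<in>T. c t * t x)" by (rule fspanE) (rule that)
  have "(\<lambda>x. \<Sum>t\<in>T. c t * t x) \<in> fspan S"
    using assms by (intro fspan_sum fspan_cmult) auto
  moreover have "f = (\<lambda>x. \<Sum>t\<in>T. c t * t x)" using c by (rule ext)
  ultimately show "f \<in> fspan S" by simp
qed

lemma fspan_mono:
  assumes "finite S" "T \<subseteq> S" shows "fspan T \<subseteq> fspan S"
  using assms by (intro fspan_subset_fspan) (auto intro: fspan_superset)

definition zclosure :: "('a \<Rightarrow> real) set \<Rightarrow> 'a set \<Rightarrow> 'a set" where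
  "zclosure H A = {x. \<forall>f\<in>H. (\<forall>y\<in>A. f y = 0) \<longrightarrow> f x = 0}"

lemma zclosureD: "x \<in> zclosure H A \<Longrightarrow> f \<in> H \<Longrightarrow> (\<And>y. y \<in> A \<Longrightarrow> f y = 0) \<Longrightarrow> f x = 0"
  unfolding zclosure_def by blast

fun free_list :: "('a \<Rightarrow> real) set \<Rightarrow> 'a list \<Rightarrow> bool" where
  "free_list H [] \<longleftrightarrow> True"
| "free_list H (x # xs) \<longleftrightarrow> x \<notin> zclosure H (set xs) \<and> free_list H xs"

lemma free_list_drop: "free_list H xs \<Longrightarrow> free_list H (drop j xs)"
proof (induction xs arbitrary: j)
  case (Cons x xs) then show ?case by (cases j) auto
qed simp

lemma free_list_length_le:
  assumes T: "finite T" "H \<subseteq> fspan T" and xs: "free_list H xs"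
  shows "length xs \<le> card T"
proof (rule ccontr)
  assume "\<not> length xs \<le> card T"
  then have "card T < card {..<length xs}" by simp
  from homogeneous_system[OF T(1) finite_lessThan this, of "\<lambda>t i. t (xs ! i)"]
  obtain u :: "nat \<Rightarrow> real" where u: "\<exists>i\<in>{..<length xs}. u i \<noteq> 0"
    "\<And>t. t \<in> T \<Longrightarrow> (\<Sum>i<length xs. t (xs ! i) * u i) = 0" by auto
  define j where "j = (LEAST i. i < length xs \<and> u i \<noteq> 0)"
  have j: "j < length xs" "u j \<noteq> 0"
    unfolding j_def using u(1) LeastI_ex[of "\<lambda>i. i < length xs \<and> u i \<noteq> 0"] by auto
  have less: "u i = 0" if "i < j" for i
    using that not_less_Least[of i "\<lambda>i. i < length xs \<and> u i \<noteq> 0"] j(1) unfolding j_def by auto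
  have "free_list H (xs ! j # drop (Suc j) xs)"
    using free_list_drop[OF xs, of j] j(1) by (simp add: Cons_nth_drop_Suc)
  then obtain f where f: "f \<in> H" "\<And>y. y \<in> set (drop (Suc j) xs) \<Longrightarrow> f y = 0" "f (xs ! j) \<noteq> 0"
    by (auto simp: zclosure_def)
  obtain c where c: "\<And>x. f x = (\<Sum>t\<in>T. c t * t x)" by (rule fspanE[OF subsetD[OF T(2) f(1)]]) (rule that)
  have "(\<Sum>i<length xs. f (xs ! i) * u i) = (\<Sum>t\<in>T. c t * (\<Sum>i<length xs. t (xs ! i) * u i))"
    unfolding c sum_distrib_left sum_distrib_right by (subst sum.swap) (simp add: mult.assoc)
  also have "\<dots> = 0" using u(2) by simp
  finally have "(\<Sum>i<length xs. f (xs ! i) * u i) = 0" .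
  moreover have zero: "f (xs ! i) * u i = 0" if "i < length xs" "i \<noteq> j" for i
  proof (cases "i < j")
    case False
    then have "xs ! i \<in> set (drop (Suc j) xs)"
      using that by (auto simp: in_set_conv_nth intro!: exI[of _ "i - Suc j"])
    then show ?thesis using f(2) by simp
  qed (simp add: less)
  have "(\<Sum>i\<in>{..<length xs} - {j}. f (xs ! i) * u i) = 0"
    using zero by (intro sum.neutral) blast
  then have "(\<Sum>i<length xs. f (xs ! i) * u i) = f (xs ! j) * u j"
    using j(1) by (simp add: sum.remove[of _ j])
  ultimately show False using f(3) j(2) by simp
qed

lemma ex_finite_zclosure_basis:
  assumes T: "finite T" "H \<subseteq> fspan T"
  shows "\<exists>F\<subseteq>A. finite F \<and> card F \<le> card T \<and> A \<subseteq> zclosure H F"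
proof -
  let ?P = "\<lambda>xs. free_list H xs \<and> set xs \<subseteq> A"
  obtain xs where xs: "?P xs" "\<And>ys. ?P ys \<Longrightarrow> length ys \<le> length xs"
    using ex_has_greatest_nat[of ?P "[]" length "Suc (card T)"] free_list_length_le[OF T]
    by (metis free_list.simps(1) empty_subsetI less_Suc_eq_le list.set(1))
  have "x \<in> zclosure H (set xs)" if "x \<in> A" for x
    using xs(2)[of "x # xs"] xs(1) that by auto
  moreover have "card (set xs) \<le> card T"
    using free_list_length_le[OF T] xs(1) card_length[of xs] le_trans by blast
  ultimately show ?thesis using xs(1) by (intro exI[of _ "set xs"]) auto
qed

lemma ex_indecomposable:
  assumes T: "finite T" "H \<subseteq> fspan T" and P: "P X"
  shows "\<exists>Z. P Z \<and> (\<forall>f\<in>H. (\<forall>x\<in>Z. f x = 0) \<or> \<not> P {x \<in> Z. f x = 0})"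
proof -
  define R where "R d \<longleftrightarrow> (\<exists>Z. P Z \<and> (\<forall>xs. free_list H xs \<and> set xs \<subseteq> Z \<longrightarrow> length xs \<le> d))" for d
  define d where "d = Least R"
  have "R (card T)" unfolding R_def using P free_list_length_le[OF T] by blast
  then have "R d" unfolding d_def by (rule LeastI)
  then obtain Z where Z: "P Z" "\<And>xs. free_list H xs \<Longrightarrow> set xs \<subseteq> Z \<Longrightarrow> length xs \<le> d"
    unfolding R_def by blast
  have "\<not> P {x \<in> Z. f x = 0}" if f: "f \<in> H" "x \<in> Z" "f x \<noteq> 0" for f x
  proof
    assume P': "P {x \<in> Z. f x = 0}"
    have *: "Suc (length xs) \<le> d" if "free_list H xs" "set xs \<subseteq> {x \<in> Z. f x = 0}" for xs
    proof -
      have "x \<notin> zclosure H (set xs)" unfolding zclosure_def using that(2) f by blast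
      then have "free_list H (x # xs)" using that(1) by simp
      moreover have "set (x # xs) \<subseteq> Z" using that(2) f(2) by auto
      ultimately show ?thesis using Z(2)[of "x # xs"] by simp
    qed
    have "Suc 0 \<le> d" using *[of "[]"] by simp
    then obtain e where e: "d = Suc e" by (cases d) auto
    have "R e" unfolding R_def
      using P' *[unfolded e Suc_le_mono] by (intro exI[of _ "{x \<in> Z. f x = 0}"]) simp
    then have "d \<le> e" unfolding d_def by (rule Least_le)
    then show False using e by simp
  qed
  then show ?thesis using Z(1) by (intro exI[of _ Z]) auto
qed

lemma ex_finite_common_zeros:
  assumes T: "finite T" "H \<subseteq> fspan T"
  shows "\<exists>F\<subseteq>H. finite F \<and> {x \<in> X. \<forall>f\<in>F. f x = 0} = {x \<in> X. \<forall>f\<in>H. f x = 0}"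
proof -
  define P where "P Z \<longleftrightarrow> (\<exists>F\<subseteq>H. finite F \<and> Z = {x \<in> X. \<forall>f\<in>F. f x = 0})" for Z
  have "P X" unfolding P_def by (intro exI[of _ "{}"]) auto
  from ex_indecomposable[where P = P, OF T this] obtain Z where
    Z: "P Z" and max: "\<And>f. f \<in> H \<Longrightarrow> (\<forall>x\<in>Z. f x = 0) \<or> \<not> P {x \<in> Z. f x = 0}"
    by blast
  then obtain F where F: "F \<subseteq> H" "finite F" "Z = {x \<in> X. \<forall>f\<in>F. f x = 0}"
    unfolding P_def by blast
  have "f x = 0" if "f \<in> H" "x \<in> Z" for f x
  proof -
    have "P {x \<in> Z. f x = 0}" unfolding P_def
      using F that(1) by (intro exI[of _ "insert f F"]) auto
    then show ?thesis using max[OF that(1)] that(2) by blast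
  qed
  then show ?thesis using F by (intro exI[of _ F]) blast
qed

section \<open>Sums of products of functions of one coordinate\<close>

inductive_set sep :: "nat \<Rightarrow> ('a \<Rightarrow> real) set \<Rightarrow> ((nat \<Rightarrow> 'a) \<Rightarrow> real) set"
  for k :: nat and G :: "('a \<Rightarrow> real) set" where
  sep_prod: "(\<And>i. i < k \<Longrightarrow> g i \<in> G) \<Longrightarrow> (\<lambda>a. \<Prod>i<k. g i (a i)) \<in> sep k G"
| sep_add: "p \<in> sep k G \<Longrightarrow> q \<in> sep k G \<Longrightarrow> (\<lambda>a. p a + q a) \<in> sep k G"

definition slices :: "nat \<Rightarrow> ((nat \<Rightarrow> 'a) \<Rightarrow> real) \<Rightarrow> ('a \<Rightarrow> real) set" where
  "slices k q = {\<lambda>x. q (a(i := x)) | a i. i < k}"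

lemma slicesI: "i < k \<Longrightarrow> (\<lambda>x. q (a(i := x))) \<in> slices k q"
  unfolding slices_def by blast

lemma slices_subset_fspan:
  assumes "q \<in> sep k G"
  shows "\<exists>T\<subseteq>G. finite T \<and> slices k q \<subseteq> fspan T"
  using assms
proof induction
  case (sep_prod g)
  have "(\<lambda>x. \<Prod>j<k. g j ((a(i := x)) j)) \<in> fspan (g ` {..<k})" if "i < k" for a i
  proof -
    have "(\<Prod>j<k. g j ((a(i := x)) j)) = (\<Prod>j\<in>{..<k} - {i}. g j (a j)) * g i x" for x
      using that by (simp add: prod.remove[of _ i])
    then show ?thesis
      using that by (auto intro!: fspan_cmult fspan_superset)
  qed
  then show ?case
    using sep_prod by (intro exI[of _ "g ` {..<k}"]) (auto simp: slices_def)
next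
  case (sep_add p q)
  obtain T where T: "T \<subseteq> G" "finite T" "slices k p \<subseteq> fspan T" using sep_add.IH(1) by blast
  obtain S where S: "S \<subseteq> G" "finite S" "slices k q \<subseteq> fspan S" using sep_add.IH(2) by blast
  have "slices k p \<subseteq> fspan (T \<union> S)" "slices k q \<subseteq> fspan (T \<union> S)"
    using T S fspan_mono[of "T \<union> S" T] fspan_mono[of "T \<union> S" S] by auto
  then have "slices k (\<lambda>a. p a + q a) \<subseteq> fspan (T \<union> S)"
    unfolding slices_def[of k "\<lambda>a. p a + q a"]
    by (auto intro!: fspan_add dest: slicesI)
  then show ?case using T S by (intro exI[of _ "T \<union> S"]) auto
qed

lemma sep_mult:
  assumes G: "\<And>f g. f \<in> G \<Longrightarrow> g \<in> G \<Longrightarrow> (\<lambda>x. f x * g x) \<in> G"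
    and p: "p \<in> sep k G" and q: "q \<in> sep k G"
  shows "(\<lambda>a. p a * q a) \<in> sep k G"
  using p
proof induction
  case (sep_prod g)
  show ?case using q
  proof induction
    case (sep_prod h)
    have "(\<lambda>a. \<Prod>i<k. g i (a i) * h i (a i)) \<in> sep k G"
      using sep.sep_prod[of k "\<lambda>i x. g i x * h i x"] G sep_prod \<open>\<And>i. i < k \<Longrightarrow> g i \<in> G\<close> by simp
    then show ?case by (simp add: prod.distrib)
  next
    case (sep_add p q)
    then show ?case by (simp add: distrib_left sep.sep_add)
  qed
next
  case (sep_add p p')
  then show ?case by (simp add: distrib_right sep.sep_add)
qed

lemma sep_coord:
  assumes one: "(\<lambda>x. 1) \<in> G" and i: "i < k" and g: "g \<in> G"
  shows "(\<lambda>a. g (a i)) \<in> sep k G"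
proof -
  have "(\<Prod>j<k. (if j = i then g else (\<lambda>x. 1)) (a j)) = g (a i)" for a
    using i by (subst prod.remove[of _ i]) (auto intro!: prod.neutral)
  then show ?thesis
    using sep_prod[of k "\<lambda>j. if j = i then g else (\<lambda>x. 1)" G] one g by simp
qed

lemma sep_finite_prod:
  assumes G: "\<And>f g. f \<in> G \<Longrightarrow> g \<in> G \<Longrightarrow> (\<lambda>x. f x * g x) \<in> G" and one: "(\<lambda>x. 1) \<in> G"
    and "0 < k" and Q: "\<And>s. s \<in> S \<Longrightarrow> Q s \<in> sep k G"
  shows "(\<lambda>a. \<Prod>s\<in>S. Q s a) \<in> sep k G"
  using Q
proof (induction S rule: infinite_finite_induct)
  case (infinite S)
  show ?case using sep_coord[OF one \<open>0 < k\<close> one] infinite(1) by simp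
next
  case empty
  show ?case using sep_coord[OF one \<open>0 < k\<close> one] by simp
next
  case (insert s S)
  have "(\<lambda>a. Q s a * (\<Prod>s\<in>S. Q s a)) \<in> sep k G"
    by (rule sep_mult[OF G]) (use insert in auto)
  then show ?case using insert by simp
qed

lemma sep_reindex:
  assumes G: "\<And>f g. f \<in> G' \<Longrightarrow> g \<in> G' \<Longrightarrow> (\<lambda>x. f x * g x) \<in> G'" and one: "(\<lambda>x. 1) \<in> G'"
    and c: "\<And>g i. g \<in> G \<Longrightarrow> i < k \<Longrightarrow> (\<lambda>x. g (c x i)) \<in> G'"
    and \<tau>: "\<And>i. i < k \<Longrightarrow> \<tau> i < k"
    and q: "q \<in> sep k G"
  shows "(\<lambda>a. q (\<lambda>i. c (a (\<tau> i)) i)) \<in> sep k G'"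
  using q
proof induction
  case (sep_prod g)
  have fin: "(\<lambda>x. \<Prod>i\<in>I. g i (c x i)) \<in> G'" if "I \<subseteq> {..<k}" for I
    using finite_subset[OF that finite_lessThan] that
  proof (induction I rule: finite_induct)
    case (insert i I)
    then show ?case using G[OF c[of "g i" i], of "\<lambda>x. \<Prod>i\<in>I. g i (c x i)"] sep_prod by simp
  qed (simp add: one)
  have "(\<Prod>i<k. g i (c (a (\<tau> i)) i)) = (\<Prod>j<k. \<Prod>i\<in>{i\<in>{..<k}. \<tau> i = j}. g i (c (a j) i))" for a
    using \<tau> by (subst prod.group[of "{..<k}" "{..<k}" \<tau> , symmetric]) (auto intro!: prod.cong)
  moreover have "(\<lambda>a. \<Prod>j<k. \<Prod>i\<in>{i\<in>{..<k}. \<tau> i = j}. g i (c (a j) i)) \<in> sep k G'"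
    by (rule sep.sep_prod[of k "\<lambda>j x. \<Prod>i\<in>{i\<in>{..<k}. \<tau> i = j}. g i (c x i)" G', OF fin]) auto
  ultimately show ?case by simp
qed (rule sep_add)

lemma sep_cong:
  assumes "q \<in> sep k G" "\<And>i. i < k \<Longrightarrow> a i = b i"
  shows "q a = q b"
  using assms by (induction) (auto intro!: prod.cong)

section \<open>Large generic subsets\<close>

unbundle cardinal_syntax

lemma not_card_of_ordLeq: "\<not> |A| \<le>o |B| \<longleftrightarrow> |B| <o |A|"
  by (rule not_ordLeq_iff_ordLess[OF card_of_Well_order card_of_Well_order])

lemma not_card_of_ordLess: "\<not> |A| <o |B| \<longleftrightarrow> |B| \<le>o |A|"
  by (rule not_ordLess_iff_ordLeq[OF card_of_Well_order card_of_Well_order])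

lemma card_of_image_ordLess: "|A| <o r \<Longrightarrow> |f ` A| <o r"
  by (rule ordLeq_ordLess_trans[OF card_of_image])

lemma finite_card_of_ordLess: "finite A \<Longrightarrow> infinite B \<Longrightarrow> |A| <o |B|"
  by (rule finite_ordLess_infinite) (simp_all add: Field_card_of card_of_well_order_on)

lemma card_of_Un_ordLeq:
  assumes "infinite B" "|A| \<le>o |B|" "|C| \<le>o |B|"
  shows "|A \<union> C| \<le>o |B|"
  by (rule card_of_Un_ordLeq_infinite_Field[OF _ _ _ card_of_Card_order]) (use assms in \<open>simp_all add: Field_card_of\<close>)

lemma card_of_Times_ordLess:
  assumes "infinite X" "|A| <o |X|" "|B| <o |X|"
  shows "|A \<times> B| <o |X|"
proof (cases "finite (A \<times> B)")
  case True
  then show ?thesis using assms(1) finite_card_of_ordLess by blast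
next
  case False
  have "infinite (A <+> B)" using False by (auto simp: finite_Plus_iff)
  moreover have "|A| \<le>o |A <+> B|" "|B| \<le>o |A <+> B|" by (rule card_of_Plus1 card_of_Plus2)+
  ultimately have "|A \<times> B| \<le>o |A <+> B|" by (intro card_of_Sigma_ordLeq_infinite) auto
  moreover have "|A <+> B| <o |X|" using assms by (rule card_of_Plus_ordLess_infinite)
  ultimately show ?thesis by (rule ordLeq_ordLess_trans)
qed

definition words :: "'a set \<Rightarrow> nat \<Rightarrow> 'a list set" where
  "words A k = {xs. set xs \<subseteq> A \<and> length xs = k}"

lemma words_0: "words A 0 = {[]}"
  by (auto simp: words_def)

lemma words_Suc: "words A (Suc k) = (\<lambda>(x, xs). x # xs) ` (A \<times> words A k)"
  by (auto simp: words_def length_Suc_conv image_iff)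

lemma card_of_words_ordLeq:
  assumes "infinite B" "|A| \<le>o |B|"
  shows "|words A k| \<le>o |B|"
proof (induction k)
  case 0
  show ?case unfolding words_0 using assms(1) by (intro card_of_singl_ordLeq) auto
next
  case (Suc k)
  have "|words A (Suc k)| \<le>o |A \<times> words A k|" unfolding words_Suc by (rule card_of_image)
  also have "|A \<times> words A k| \<le>o |B|" using assms Suc by (intro card_of_Sigma_ordLeq_infinite) auto
  finally show ?case .
qed

lemma card_of_words_ordLess:
  assumes "infinite X" "|A| <o |X|"
  shows "|words A k| <o |X|"
proof (induction k)
  case 0
  show ?case unfolding words_0 using assms(1) by (intro finite_card_of_ordLess) auto
next
  case (Suc k)
  have "|words A (Suc k)| \<le>o |A \<times> words A k|" unfolding words_Suc by (rule card_of_image)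
  then show ?case using card_of_Times_ordLess[OF assms(1) assms(2) Suc] by (rule ordLeq_ordLess_trans)
qed

text \<open>A slot \<open>s i\<close> is either a member of \<open>J\<close>, standing for an undetermined point of it, or a
  singleton, standing for a chosen point of \<open>Y\<close>.\<close>
definition generic :: "nat \<Rightarrow> ((nat \<Rightarrow> 'a) \<Rightarrow> real) \<Rightarrow> 'a set set \<Rightarrow> 'a set \<Rightarrow> bool" where
  "generic k q J Y \<longleftrightarrow> (\<forall>s. (\<forall>i<k. s i \<in> J \<union> (\<lambda>y. {y}) ` Y)
     \<and> (\<forall>i<k. \<forall>j<k. i \<noteq> j \<and> s i = s j \<longrightarrow> s i \<in> J)
     \<longrightarrow> (\<exists>a. (\<forall>i<k. a i \<in> s i) \<and> q a \<noteq> 0))"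

lemma genericD:
  assumes "generic k q J Y" "\<And>i. i < k \<Longrightarrow> s i \<in> J \<union> (\<lambda>y. {y}) ` Y"
    and "\<And>i j. i < k \<Longrightarrow> j < k \<Longrightarrow> i \<noteq> j \<Longrightarrow> s i = s j \<Longrightarrow> s i \<in> J"
  shows "\<exists>a. (\<forall>i<k. a i \<in> s i) \<and> q a \<noteq> 0"
  using assms unfolding generic_def by auto

lemma genericI:
  assumes "\<And>s. (\<And>i. i < k \<Longrightarrow> s i \<in> J \<union> (\<lambda>y. {y}) ` Y) \<Longrightarrow>
     (\<And>i j. i < k \<Longrightarrow> j < k \<Longrightarrow> i \<noteq> j \<Longrightarrow> s i = s j \<Longrightarrow> s i \<in> J) \<Longrightarrow>
     (\<exists>a. (\<forall>i<k. a i \<in> s i) \<and> q a \<noteq> 0)"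
  shows "generic k q J Y"
  using assms unfolding generic_def by auto

lemma generic_nonzero:
  assumes gen: "generic k q J Y" and q: "q \<in> sep k G"
    and a: "inj_on a {..<k}" "a ` {..<k} \<subseteq> Y"
  shows "q a \<noteq> 0"
proof -
  have "\<exists>b. (\<forall>i<k. b i \<in> {a i}) \<and> q b \<noteq> 0"
    by (rule genericD[OF gen, of "\<lambda>i. {a i}"]) (use a in \<open>auto simp: inj_on_def\<close>)
  then obtain b where b: "\<And>i. i < k \<Longrightarrow> b i = a i" "q b \<noteq> 0" by auto
  show ?thesis using sep_cong[OF q, of b a] b by auto
qed

lemma generic_Union_chain:
  assumes C: "C \<noteq> {}" "subset.chain UNIV C" and gen: "\<And>Y. Y \<in> C \<Longrightarrow> generic k q J Y"
  shows "generic k q J (\<Union>C)"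
proof (rule genericI)
  fix s assume s: "\<And>i. i < k \<Longrightarrow> s i \<in> J \<union> (\<lambda>y. {y}) ` \<Union>C"
    "\<And>i j. i < k \<Longrightarrow> j < k \<Longrightarrow> i \<noteq> j \<Longrightarrow> s i = s j \<Longrightarrow> s i \<in> J"
  define F where "F = {y \<in> \<Union>C. \<exists>i<k. s i = {y}}"
  have "F \<subseteq> (\<lambda>i. the_elem (s i)) ` {..<k}"
    unfolding F_def by (auto simp: image_iff) (metis lessThan_iff the_elem_eq)
  then have "finite F" using finite_surj by blast
  moreover have "F \<subseteq> \<Union>C" unfolding F_def by blast
  ultimately obtain Y where Y: "Y \<in> C" "F \<subseteq> Y"
    using finite_subset_Union_chain[OF _ _ C] by metis
  show "\<exists>a. (\<forall>i<k. a i \<in> s i) \<and> q a \<noteq> 0"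
  proof (rule genericD[OF gen[OF Y(1)]])
    fix i assume "i < k"
    then show "s i \<in> J \<union> (\<lambda>y. {y}) ` Y" using s(1)[of i] Y(2) by (auto simp: F_def)
  qed (use s(2) in auto)
qed

text \<open>A point of \<open>V\<close> that cannot be added to a maximal generic set is a zero of a slice taken at
  one of the tuples witnessing genericity.\<close>
lemma ex_maximal_generic:
  assumes gen: "generic k q J {}"
  shows "\<exists>Y\<subseteq>\<Union>J. generic k q J Y \<and> (\<forall>V\<in>J. \<exists>\<Phi>\<subseteq>slices k q.
    |\<Phi>| \<le>o |words (J \<union> (\<lambda>y. {y}) ` Y) k \<times> {..<k}| \<and>
    (\<forall>f\<in>\<Phi>. \<exists>x\<in>V. f x \<noteq> 0) \<and> V \<subseteq> Y \<union> (\<Union>f\<in>\<Phi>. {x \<in> V. f x = 0}))"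
proof -
  let ?A = "{Y. Y \<subseteq> \<Union>J \<and> generic k q J Y}"
  have "\<exists>M\<in>?A. \<forall>X\<in>?A. M \<subseteq> X \<longrightarrow> X = M"
  proof (rule subset_Zorn_nonempty)
    show "?A \<noteq> {}" using gen by auto
    fix C assume C: "C \<noteq> {}" "subset.chain ?A C"
    then have "subset.chain UNIV C" "C \<subseteq> ?A" by (auto simp: subset_chain_def)
    then show "\<Union>C \<in> ?A" using generic_Union_chain[OF C(1)] by blast
  qed
  then obtain Y where Y: "Y \<subseteq> \<Union>J" "generic k q J Y"
    and max: "\<And>X. X \<subseteq> \<Union>J \<Longrightarrow> generic k q J X \<Longrightarrow> Y \<subseteq> X \<Longrightarrow> X = Y" by auto
  let ?L = "words (J \<union> (\<lambda>y. {y}) ` Y) k"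
  define wit where "wit xs = (SOME a. (\<forall>i<k. a i \<in> xs ! i) \<and> q a \<noteq> 0)" for xs :: "'a set list"
  define sl where "sl = (\<lambda>(xs, i) x. q ((wit xs)(i := x)))"
  have "\<exists>\<Phi>\<subseteq>slices k q. |\<Phi>| \<le>o |?L \<times> {..<k}| \<and>
    (\<forall>f\<in>\<Phi>. \<exists>x\<in>V. f x \<noteq> 0) \<and> V \<subseteq> Y \<union> (\<Union>f\<in>\<Phi>. {x \<in> V. f x = 0})" if V: "V \<in> J" for V
  proof -
    let ?I = "{t \<in> ?L \<times> {..<k}. \<exists>x\<in>V. sl t x \<noteq> 0}"
    have "|sl ` ?I| \<le>o |?I|" by (rule card_of_image)
    also have "|?I| \<le>o |?L \<times> {..<k}|" by (rule card_of_mono1) auto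
    finally have card: "|sl ` ?I| \<le>o |?L \<times> {..<k}|" .
    have "\<exists>f\<in>sl ` ?I. f y = 0" if y: "y \<in> V" "y \<notin> Y" for y
    proof (rule ccontr)
      assume bad: "\<not> (\<exists>f\<in>sl ` ?I. f y = 0)"
      have "generic k q J (insert y Y)"
      proof (rule genericI)
        fix s assume s: "\<And>i. i < k \<Longrightarrow> s i \<in> J \<union> (\<lambda>y. {y}) ` insert y Y"
          "\<And>i j. i < k \<Longrightarrow> j < k \<Longrightarrow> i \<noteq> j \<Longrightarrow> s i = s j \<Longrightarrow> s i \<in> J"
        show "\<exists>a. (\<forall>i<k. a i \<in> s i) \<and> q a \<noteq> 0"
        proof (cases "\<exists>i<k. s i = {y} \<and> s i \<notin> J")
          case False
          show ?thesis
          proof (rule genericD[OF Y(2)])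
            fix i assume "i < k"
            then show "s i \<in> J \<union> (\<lambda>y. {y}) ` Y" using s(1)[of i] False by blast
          qed (use s(2) in blast)
        next
          case True
          then obtain i where i: "i < k" "s i = {y}" "s i \<notin> J" by auto
          define s' where "s' = s(i := V)"
          define xs where "xs = map s' [0..<k]"
          have nth: "xs ! j = s' j" if "j < k" for j using that by (simp add: xs_def)
          have s'J: "s' j \<in> J \<union> (\<lambda>y. {y}) ` Y" if "j < k" for j
            using s(1)[of j] s(2)[of i j] i that V by (auto simp: s'_def)
          have "\<exists>a. (\<forall>j<k. a j \<in> s' j) \<and> q a \<noteq> 0"
            by (rule genericD[OF Y(2) s'J]) (use s(2) V in \<open>auto simp: s'_def split: if_splits\<close>)
          then have "\<exists>a. (\<forall>j<k. a j \<in> xs ! j) \<and> q a \<noteq> 0" using nth by auto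
          then have "(\<forall>j<k. wit xs j \<in> xs ! j) \<and> q (wit xs) \<noteq> 0"
            unfolding wit_def by (rule someI_ex)
          then have w: "\<And>j. j < k \<Longrightarrow> wit xs j \<in> s' j" "q (wit xs) \<noteq> 0" using nth by auto
          have "s' ` {..<k} \<subseteq> J \<union> (\<lambda>y. {y}) ` Y" using s'J by blast
          then have "xs \<in> ?L" by (simp add: words_def xs_def atLeast0LessThan)
          moreover have "wit xs i \<in> V" using w(1)[OF i(1)] by (simp add: s'_def)
          moreover have "sl (xs, i) (wit xs i) \<noteq> 0" using w(2) by (simp add: sl_def)
          ultimately have "(xs, i) \<in> ?I" using i(1) by blast
          then have "sl (xs, i) y \<noteq> 0" using bad by blast
          then have "q ((wit xs)(i := y)) \<noteq> 0" by (simp add: sl_def)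
          moreover have "\<forall>j<k. ((wit xs)(i := y)) j \<in> s j"
          proof (intro allI impI)
            fix j assume "j < k"
            then show "((wit xs)(i := y)) j \<in> s j" using w(1)[OF \<open>j < k\<close>] i(2) by (simp add: s'_def split: if_split_asm)
          qed
          ultimately show ?thesis by (intro exI[of _ "(wit xs)(i := y)"]) simp
        qed
      qed
      then have "insert y Y = Y" using Y(1) y(1) V by (intro max) auto
      then show False using y(2) by auto
    qed
    then have cov: "V \<subseteq> Y \<union> (\<Union>f\<in>\<Phi>. {x \<in> V. f x = 0})" if "\<Phi> = sl ` ?I" for \<Phi>
      unfolding that[symmetric] by blast
    have "sl ` ?I \<subseteq> slices k q"
      unfolding sl_def by (auto intro: slicesI)
    moreover have "\<forall>f\<in>sl ` ?I. \<exists>x\<in>V. f x \<noteq> 0" by fast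
    ultimately show ?thesis using card cov[OF refl] by (intro exI[of _ "sl ` ?I"] conjI)
  qed
  then show ?thesis using Y by blast
qed

definition card_regular :: "'a set \<Rightarrow> bool" where
  "card_regular X \<longleftrightarrow> (\<forall>F::'a set set. |F| <o |X| \<longrightarrow> (\<forall>D\<in>F. |D| <o |X| ) \<longrightarrow> |\<Union>F| <o |X| )"

lemma large_generic_subset_regular:
  fixes q :: "(nat \<Rightarrow> 'a) \<Rightarrow> real"
  assumes q: "q \<in> sep k G" and X: "infinite X" "card_regular X"
    and nz: "\<And>A. A \<subseteq> X \<Longrightarrow> infinite A \<Longrightarrow> \<exists>a. (\<forall>i<k. a i \<in> A) \<and> q a \<noteq> 0"
  shows "\<exists>Y\<subseteq>X. |X| \<le>o |Y| \<and> (\<forall>a. inj_on a {..<k} \<and> a ` {..<k} \<subseteq> Y \<longrightarrow> q a \<noteq> 0)"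
proof -
  obtain T where T: "finite T" "slices k q \<subseteq> fspan T" using slices_subset_fspan[OF q] by blast
  define P where "P Z \<longleftrightarrow> Z \<subseteq> X \<and> |X| \<le>o |Z|" for Z
  have "P X" by (simp add: P_def card_of_mono1)
  from ex_indecomposable[where P = P, OF T this] obtain Z where Z: "P Z"
    and ind: "\<And>f. f \<in> slices k q \<Longrightarrow> (\<forall>x\<in>Z. f x = 0) \<or> \<not> P {x \<in> Z. f x = 0}" by blast
  have ZX: "Z \<subseteq> X" "|X| \<le>o |Z|" using Z by (auto simp: P_def)
  then have "infinite Z" using X(1) card_of_ordLeq_infinite by blast
  obtain a where a: "\<And>i. i < k \<Longrightarrow> a i \<in> Z" "q a \<noteq> 0" using nz[OF ZX(1) \<open>infinite Z\<close>] by blast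
  have "generic k q {Z} {}"
    by (rule genericI) (use a in \<open>auto intro!: exI[of _ a]\<close>)
  from ex_maximal_generic[OF this] obtain Y \<Phi> where Y: "Y \<subseteq> Z" "generic k q {Z} Y" and
    \<Phi>: "\<Phi> \<subseteq> slices k q" "|\<Phi>| \<le>o |words ({Z} \<union> (\<lambda>y. {y}) ` Y) k \<times> {..<k}|"
      "\<And>f. f \<in> \<Phi> \<Longrightarrow> \<exists>x\<in>Z. f x \<noteq> 0" "Z \<subseteq> Y \<union> (\<Union>f\<in>\<Phi>. {x \<in> Z. f x = 0})"
    by auto
  have "|X| \<le>o |Y|"
  proof (rule ccontr)
    assume "\<not> |X| \<le>o |Y|"
    then have Yless: "|Y| <o |X|" by (simp only: not_card_of_ordLeq)
    have "|(\<lambda>y. {y}) ` Y| <o |X|" using Yless by (rule card_of_image_ordLess)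
    then have "|{Z} \<union> (\<lambda>y. {y}) ` Y| <o |X|"
      using X(1) by (intro card_of_Un_ordLess_infinite[OF _ finite_card_of_ordLess]) auto
    then have "|words ({Z} \<union> (\<lambda>y. {y}) ` Y) k \<times> {..<k}| <o |X|"
      using X(1) by (intro card_of_Times_ordLess[OF _ card_of_words_ordLess finite_card_of_ordLess]) auto
    then have "|\<Phi>| <o |X|" by (rule ordLeq_ordLess_trans[OF \<Phi>(2)])
    let ?F = "(\<lambda>f. {x \<in> Z. f x = 0}) ` \<Phi>"
    have "|?F| <o |X|" using \<open>|\<Phi>| <o |X|\<close> by (rule card_of_image_ordLess)
    moreover have "|D| <o |X|" if "D \<in> ?F" for D
    proof -
      from that obtain f where f: "f \<in> \<Phi>" "D = {x \<in> Z. f x = 0}" by blast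
      then have "\<not> P D" using ind \<Phi>(1,3) by blast
      moreover have "D \<subseteq> X" using f ZX(1) by blast
      ultimately show ?thesis
        by (simp add: P_def not_card_of_ordLeq)
    qed
    ultimately have "|\<Union>?F| <o |X|" using X(2) unfolding card_regular_def by blast
    then have "|Y \<union> \<Union>?F| <o |X|" using Yless X(1) by (intro card_of_Un_ordLess_infinite)
    moreover have "|Z| \<le>o |Y \<union> \<Union>?F|" using \<Phi>(4) by (intro card_of_mono1) simp
    ultimately have "|Z| <o |X|" by (rule ordLeq_ordLess_trans[rotated])
    then show False using ZX(2) not_card_of_ordLeq by blast
  qed
  then show ?thesis
    using Y(1) ZX(1) generic_nonzero[OF Y(2) q] by (intro exI[of _ Y]) auto
qed

text \<open>A strictly cofinal family with fewer than \<open>|X|\<close> members exists exactly if \<open>X\<close> has singular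
  cardinality; for a successor cardinal even weakly cofinal families can be singletons, hence the
  strict inequality.\<close>
definition strictly_cofinal :: "'a set \<Rightarrow> 'a set set \<Rightarrow> bool" where
  "strictly_cofinal X F \<longleftrightarrow> (\<forall>D\<in>F. |D| <o |X| ) \<and> (\<forall>S::'a set. |S| <o |X| \<longrightarrow> (\<exists>D\<in>F. |S| <o |D| ))"

lemma not_strictly_cofinalD:
  fixes F :: "'a set set"
  assumes "\<not> strictly_cofinal X F" "\<And>D. D \<in> F \<Longrightarrow> |D| <o |X|"
  shows "\<exists>S::'a set. |S| <o |X| \<and> (\<forall>D\<in>F. |D| \<le>o |S| )"
  using assms unfolding strictly_cofinal_def by (auto simp: not_card_of_ordLess)

lemma ex_strictly_cofinal:
  fixes X :: "'a set"
  assumes X: "infinite X" "\<not> card_regular X"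
  shows "\<exists>F. strictly_cofinal X F \<and> |F| <o |X|"
proof -
  obtain F :: "'a set set" where F: "|F| <o |X|" "\<And>D. D \<in> F \<Longrightarrow> |D| <o |X|" "\<not> |\<Union>F| <o |X|"
    using X(2) unfolding card_regular_def by blast
  have "strictly_cofinal X F"
  proof (rule ccontr)
    assume "\<not> strictly_cofinal X F"
    from not_strictly_cofinalD[OF this F(2)] obtain S :: "'a set"
      where S: "|S| <o |X|" "\<And>D. D \<in> F \<Longrightarrow> |D| \<le>o |S|" by blast
    have "|\<Union>F| <o |X|"
    proof (cases "finite (S <+> F)")
      case True
      then have "finite S" "finite F" by (auto simp: finite_Plus_iff)
      then have "finite (\<Union>F)" using S(2) card_of_ordLeq_finite by blast
      then show ?thesis using X(1) by (rule finite_card_of_ordLess)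
    next
      case False
      have "|D| \<le>o |S <+> F|" if "D \<in> F" for D
        using S(2)[OF that] card_of_Plus1 by (rule ordLeq_transitive)
      then have "|\<Union>D\<in>F. D| \<le>o |S <+> F|"
        using False card_of_Plus2 by (intro card_of_UNION_ordLeq_infinite) auto
      moreover have "|S <+> F| <o |X|" using X(1) S(1) F(1) by (rule card_of_Plus_ordLess_infinite)
      ultimately show ?thesis using ordLeq_ordLess_trans by simp
    qed
    then show False using F(3) by blast
  qed
  then show ?thesis using F(1) by blast
qed

lemma finite_family_max_card:
  assumes "finite F" "F \<noteq> {}"
  shows "\<exists>M\<in>F. \<forall>D\<in>F. |D| \<le>o |M|"
  using assms
proof (induction F rule: finite_ne_induct)
  case (insert D F)
  then obtain M where M: "M \<in> F" "\<And>E. E \<in> F \<Longrightarrow> |E| \<le>o |M|" by blast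
  show ?case
  proof (cases "|D| \<le>o |M|")
    case True
    then show ?thesis using M by (intro bexI[of _ M]) auto
  next
    case False
    then have "|M| \<le>o |D|"
      by (auto simp: not_card_of_ordLeq intro: ordLess_imp_ordLeq)
    then have "|E| \<le>o |D|" if "E \<in> F" for E using M(2)[OF that] ordLeq_transitive by blast
    then show ?thesis by (intro bexI[of _ D]) (auto simp: card_of_mono1)
  qed
qed (simp add: card_of_mono1)

lemma infinite_strictly_cofinal:
  assumes X: "infinite X" and F: "strictly_cofinal X F"
  shows "infinite F"
proof
  assume "finite F"
  have "|{}| <o |X|" using X by (intro finite_card_of_ordLess) auto
  then have "F \<noteq> {}" using F unfolding strictly_cofinal_def by blast
  from finite_family_max_card[OF \<open>finite F\<close> this]
  obtain M where M: "M \<in> F" "\<And>D. D \<in> F \<Longrightarrow> |D| \<le>o |M|" by blast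
  then obtain D where "D \<in> F" "|M| <o |D|" using F unfolding strictly_cofinal_def by blast
  then show False
    using M(2)[of D] not_card_of_ordLeq by blast
qed

lemma card_regular_minimal_cofinal:
  fixes X :: "'a set" and F :: "'a set set"
  assumes F: "strictly_cofinal X F"
    and min: "\<And>E::'a set set. strictly_cofinal X E \<Longrightarrow> |F| \<le>o |E|"
  shows "card_regular F"
  unfolding card_regular_def
proof (intro allI impI)
  fix W :: "'a set set set"
  assume W: "|W| <o |F|" "\<forall>E\<in>W. |E| <o |F|"
  have small: "\<exists>S::'a set. |S| <o |X| \<and> (\<forall>D\<in>E. |D| \<le>o |S| )"
    if "|E| <o |F|" "\<And>D. D \<in> E \<Longrightarrow> |D| <o |X|" for E :: "'a set set"
  proof (rule not_strictly_cofinalD[OF _ that(2)])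
    show "\<not> strictly_cofinal X E"
      using min[of E] that(1) not_card_of_ordLeq by blast
  qed
  show "|\<Union>W| <o |F|"
  proof (rule ccontr)
    assume "\<not> |\<Union>W| <o |F|"
    then have "|F| \<le>o |\<Union>W|"
      by (simp only: not_card_of_ordLess)
    then obtain h where h: "inj_on h F" "h ` F \<subseteq> \<Union>W" unfolding card_of_ordLeq[symmetric] by blast
    have "\<exists>S::'a set. |S| <o |X| \<and> (\<forall>D\<in>{D\<in>F. h D \<in> E}. |D| \<le>o |S| )" if "E \<in> W" for E
    proof (rule small)
      have "inj_on h {D\<in>F. h D \<in> E}" using h(1) by (rule inj_on_subset) auto
      then have "|{D\<in>F. h D \<in> E}| \<le>o |E|" by (intro card_of_ordLeqI[of h]) auto
      then show "|{D\<in>F. h D \<in> E}| <o |F|" using W(2) that by (auto intro: ordLeq_ordLess_trans)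
    qed (use F in \<open>auto simp: strictly_cofinal_def\<close>)
    then have "\<forall>E\<in>W. \<exists>S::'a set. |S| <o |X| \<and> (\<forall>D\<in>{D\<in>F. h D \<in> E}. |D| \<le>o |S| )" by blast
    from bchoice[OF this] obtain S :: "'a set set \<Rightarrow> 'a set" where
      S: "\<And>E. E \<in> W \<Longrightarrow> |S E| <o |X|" "\<And>E D. E \<in> W \<Longrightarrow> D \<in> F \<Longrightarrow> h D \<in> E \<Longrightarrow> |D| \<le>o |S E|"
      by blast
    have "|S ` W| <o |F|" using W(1) by (rule card_of_image_ordLess)
    then have "\<exists>R::'a set. |R| <o |X| \<and> (\<forall>D\<in>S ` W. |D| \<le>o |R| )"
      by (rule small) (use S(1) in blast)
    then obtain R :: "'a set" where R: "|R| <o |X|" "\<And>E. E \<in> W \<Longrightarrow> |S E| \<le>o |R|"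
      by blast
    obtain D where D: "D \<in> F" "|R| <o |D|" using F R(1) unfolding strictly_cofinal_def by blast
    obtain E where E: "E \<in> W" "h D \<in> E" using h(2) D(1) by blast
    have "|D| \<le>o |R|" using S(2)[OF E(1) D(1) E(2)] R(2)[OF E(1)] by (rule ordLeq_transitive)
    then show False
      using D(2) not_card_of_ordLeq by blast
  qed
qed

lemma ex_injective_reindexing:
  fixes t :: "nat \<Rightarrow> 'a"
  assumes T: "infinite T" and t: "t ` {..<k} \<subseteq> T"
  shows "\<exists>\<alpha> \<tau>. inj_on \<alpha> {..<k} \<and> \<alpha> ` {..<k} \<subseteq> T \<and> \<tau> \<in> {..<k} \<rightarrow>\<^sub>E {..<k} \<and> (\<forall>i<k. \<alpha> (\<tau> i) = t i)"
proof -
  let ?A = "t ` {..<k}"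
  have le: "card ?A \<le> k" using card_image_le[of "{..<k}" t] by simp
  have "infinite (T - ?A)" using T by simp
  then obtain B where B: "finite B" "card B = k - card ?A" "B \<subseteq> T - ?A"
    using infinite_arbitrarily_large by blast
  let ?W = "?A \<union> B"
  have "card ?W = k" using B le by (subst card_Un_disjoint) auto
  moreover have "finite ?W" using B by simp
  ultimately obtain \<alpha> where \<alpha>: "bij_betw \<alpha> {..<k} ?W"
    using ex_bij_betw_nat_finite[of ?W] by (auto simp: atLeast0LessThan)
  have "\<exists>j<k. \<alpha> j = t i" if "i < k" for i
  proof -
    have "t i \<in> \<alpha> ` {..<k}" using that bij_betw_imp_surj_on[OF \<alpha>] by simp
    then show ?thesis by (metis imageE lessThan_iff)
  qed
  then obtain \<sigma> where \<sigma>: "\<And>i. i < k \<Longrightarrow> \<sigma> i < k \<and> \<alpha> (\<sigma> i) = t i" by metis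
  have "inj_on \<alpha> {..<k}" "\<alpha> ` {..<k} \<subseteq> T"
    using \<alpha> t B by (auto simp: bij_betw_def)
  then show ?thesis using \<sigma>
    by (intro exI[of _ \<alpha>] exI[of _ "restrict \<sigma> {..<k}"]) auto
qed

text \<open>Index \<open>X\<close> by a strictly cofinal family \<open>F\<close> of least cardinality, which is regular. Each \<open>D \<in> F\<close>
  gets a set \<open>V D \<subseteq> X\<close> of more than \<open>|B D|\<close> points, indecomposable at that size, and a tuple \<open>c D\<close> in \<open>V D\<close>
  with \<open>q (c D) \<noteq> 0\<close>. The function \<open>Q\<close> on tuples of indices does not vanish on the diagonal, so the regular
  case gives many indices \<open>T\<close> for which \<open>q\<close> does not vanish on any product of sets \<open>V D\<close>, and a
  maximal generic set for these sets is as large as \<open>X\<close>.\<close>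
lemma large_generic_subset_singular:
  fixes q :: "(nat \<Rightarrow> 'a) \<Rightarrow> real"
  assumes q: "q \<in> sep k G" and k: "0 < k" and X: "infinite X" "\<not> card_regular X"
    and nz: "\<And>A. A \<subseteq> X \<Longrightarrow> infinite A \<Longrightarrow> \<exists>a. (\<forall>i<k. a i \<in> A) \<and> q a \<noteq> 0"
  shows "\<exists>Y\<subseteq>X. |X| \<le>o |Y| \<and> (\<forall>a. inj_on a {..<k} \<and> a ` {..<k} \<subseteq> Y \<longrightarrow> q a \<noteq> 0)"
proof -
  obtain H where H: "finite H" "slices k q \<subseteq> fspan H" using slices_subset_fspan[OF q] by blast
  let ?R = "{|F| | F. strictly_cofinal X F}"
  have "\<exists>r\<in>?R. \<forall>r'\<in>?R. r \<le>o r'"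
    using ex_strictly_cofinal[OF X] by (intro exists_minim_Card_order) (auto intro: card_of_Card_order)
  then obtain F where F: "strictly_cofinal X F"
    and min: "\<And>E. strictly_cofinal X E \<Longrightarrow> |F| \<le>o |E|" by blast
  obtain E where E: "strictly_cofinal X E" "|E| <o |X|" using ex_strictly_cofinal[OF X] by blast
  have FX: "|F| <o |X|" using min[OF E(1)] E(2) by (rule ordLeq_ordLess_trans)
  have Finf: "infinite F" using infinite_strictly_cofinal[OF X(1) F] .
  have Freg: "card_regular F" using card_regular_minimal_cofinal[OF F min] .
  have FsmallD: "|D| <o |X|" if "D \<in> F" for D using F that by (auto simp: strictly_cofinal_def)
  have Fcof: "\<exists>D\<in>F. |S| <o |D|" if "|S| <o |X|" for S :: "'a set"
    using F that by (auto simp: strictly_cofinal_def)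
  obtain h where h: "inj_on h F" "h ` F \<subseteq> X"
    using ordLess_imp_ordLeq[OF FX] unfolding card_of_ordLeq[symmetric] by blast
  define I where "I = h ` F"
  have I: "infinite I" "|I| <o |X|" "|F| \<le>o |I|"
    using Finf h(1) FX card_of_image_ordLess[OF FX] unfolding I_def
    by (auto simp: finite_image_iff intro!: card_of_ordLeqI[of h])
  let ?r = "|F|"
  have "\<exists>S::'a set. |S| <o |X| \<and> (\<forall>D'\<in>underS ?r D. |D'| \<le>o |S| )" if D: "D \<in> F" for D
  proof (rule not_strictly_cofinalD)
    have "|underS ?r D| <o |F|"
      using D by (intro card_of_underS card_of_Card_order) (simp add: Field_card_of)
    then show "\<not> strictly_cofinal X (underS ?r D)"
      using min not_card_of_ordLeq by blast
    fix D' assume "D' \<in> underS ?r D"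
    then have "(D', D) \<in> ?r" by (simp add: underS_def)
    then have "D' \<in> Field ?r" by (rule FieldI1)
    then have "D' \<in> F" by (simp only: Field_card_of)
    then show "|D'| <o |X|" by (rule FsmallD)
  qed
  then have "\<forall>D\<in>F. \<exists>S::'a set. |S| <o |X| \<and> (\<forall>D'\<in>underS ?r D. |D'| \<le>o |S| )" by blast
  from bchoice[OF this] obtain S :: "'a set \<Rightarrow> 'a set" where
    "\<forall>D\<in>F. |S D| <o |X| \<and> (\<forall>D'\<in>underS ?r D. |D'| \<le>o |S D| )" ..
  then have S: "\<And>D. D \<in> F \<Longrightarrow> |S D| <o |X|"
    "\<And>D D'. D \<in> F \<Longrightarrow> D' \<in> underS ?r D \<Longrightarrow> |D'| \<le>o |S D|" by simp_all
  define B where "B D = S D \<union> I" for D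
  have Binf: "infinite (B D)" for D using I(1) by (simp add: B_def)
  have BX: "|B D| <o |X|" if "D \<in> F" for D
    unfolding B_def using X(1) S(1)[OF that] I(2) by (rule card_of_Un_ordLess_infinite)
  have SB: "|S D| \<le>o |B D|" and IB: "|I| \<le>o |B D|" for D
    by (auto simp: B_def intro!: card_of_mono1)
  have "\<exists>Z. (Z \<subseteq> X \<and> |B D| <o |Z| ) \<and> (\<forall>f\<in>slices k q. (\<forall>x\<in>Z. f x = 0) \<or> |{x \<in> Z. f x = 0}| \<le>o |B D| )"
    if D: "D \<in> F" for D
  proof -
    define P where "P Z \<longleftrightarrow> Z \<subseteq> X \<and> |B D| <o |Z|" for Z
    have "P X" using BX[OF D] by (simp add: P_def)
    from ex_indecomposable[where P = P, OF H this] obtain Z where Z: "P Z"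
      and ind: "\<And>f. f \<in> slices k q \<Longrightarrow> (\<forall>x\<in>Z. f x = 0) \<or> \<not> P {x \<in> Z. f x = 0}" by blast
    have "|{x \<in> Z. f x = 0}| \<le>o |B D|" if "\<not> P {x \<in> Z. f x = 0}" for f
    proof -
      have "{x \<in> Z. f x = 0} \<subseteq> X" using Z by (auto simp: P_def)
      then show ?thesis using that by (simp add: P_def not_card_of_ordLess)
    qed
    then show ?thesis using Z ind unfolding P_def by (intro exI[of _ Z]) blast
  qed
  then have "\<forall>D\<in>F. \<exists>Z. (Z \<subseteq> X \<and> |B D| <o |Z| ) \<and> (\<forall>f\<in>slices k q. (\<forall>x\<in>Z. f x = 0) \<or> |{x \<in> Z. f x = 0}| \<le>o |B D| )"
    by blast
  from bchoice[OF this] obtain V where V: "\<And>D. D \<in> F \<Longrightarrow> V D \<subseteq> X" "\<And>D. D \<in> F \<Longrightarrow> |B D| <o |V D|"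
    "\<And>D f. D \<in> F \<Longrightarrow> f \<in> slices k q \<Longrightarrow> (\<forall>x\<in>V D. f x = 0) \<or> |{x \<in> V D. f x = 0}| \<le>o |B D|"
    by blast
  have Vinf: "infinite (V D)" if "D \<in> F" for D
    using card_of_ordLeq_infinite[OF ordLess_imp_ordLeq[OF V(2)[OF that]] Binf] .
  have "\<forall>D\<in>F. \<exists>a. (\<forall>i<k. a i \<in> V D) \<and> q a \<noteq> 0" using nz V(1) Vinf by blast
  from bchoice[OF this] obtain c where c: "\<And>D i. D \<in> F \<Longrightarrow> i < k \<Longrightarrow> c D i \<in> V D" "\<And>D. D \<in> F \<Longrightarrow> q (c D) \<noteq> 0"
    by blast
  let ?M = "{..<k} \<rightarrow>\<^sub>E {..<k}"
  define Q where "Q \<alpha> = (\<Prod>\<tau>\<in>?M. q (\<lambda>i. c (\<alpha> (\<tau> i)) i))" for \<alpha>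
  have Mfin: "finite ?M" by (intro finite_PiE) auto
  have "(\<lambda>\<alpha>. q (\<lambda>i. c (\<alpha> (\<tau> i)) i)) \<in> sep k UNIV" if "\<tau> \<in> ?M" for \<tau>
    by (rule sep_reindex[OF _ _ _ _ q]) (use that in auto)
  then have "Q \<in> sep k UNIV"
    unfolding Q_def using k by (intro sep_finite_prod) auto
  moreover have "\<exists>\<alpha>. (\<forall>i<k. \<alpha> i \<in> A) \<and> Q \<alpha> \<noteq> 0" if A: "A \<subseteq> F" "infinite A" for A
  proof -
    obtain D where "D \<in> A" using A(2) by fastforce
    then have "Q (\<lambda>i. D) \<noteq> 0" using c(2) A(1) Mfin by (auto simp: Q_def)
    then show ?thesis using \<open>D \<in> A\<close> by (intro exI[of _ "\<lambda>i. D"]) simp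
  qed
  ultimately obtain T where T: "T \<subseteq> F" "|F| \<le>o |T|"
    and QT: "\<And>\<alpha>. inj_on \<alpha> {..<k} \<Longrightarrow> \<alpha> ` {..<k} \<subseteq> T \<Longrightarrow> Q \<alpha> \<noteq> 0"
    using large_generic_subset_regular[of Q k UNIV F] Finf Freg by blast
  have Tinf: "infinite T" using card_of_ordLeq_infinite[OF T(2) Finf] .
  have gen0: "generic k q (V ` T) {}"
  proof (rule genericI)
    fix s assume "\<And>i. i < k \<Longrightarrow> s i \<in> V ` T \<union> (\<lambda>y. {y}) ` {}"
    then have "\<forall>i\<in>{..<k}. \<exists>D. D \<in> T \<and> s i = V D" by auto
    from bchoice[OF this] obtain t where t: "\<And>i. i < k \<Longrightarrow> t i \<in> T" "\<And>i. i < k \<Longrightarrow> s i = V (t i)" by blast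
    have "t ` {..<k} \<subseteq> T" using t(1) by blast
    from ex_injective_reindexing[OF Tinf this] obtain \<alpha> \<tau> where
      \<alpha>: "inj_on \<alpha> {..<k}" "\<alpha> ` {..<k} \<subseteq> T" "\<tau> \<in> ?M" "\<And>i. i < k \<Longrightarrow> \<alpha> (\<tau> i) = t i" by blast
    have "q (\<lambda>i. c (\<alpha> (\<tau> i)) i) \<noteq> 0"
      using QT[OF \<alpha>(1,2)] Mfin \<alpha>(3) by (auto simp: Q_def)
    moreover have "q (\<lambda>i. c (\<alpha> (\<tau> i)) i) = q (\<lambda>i. c (t i) i)"
      by (rule sep_cong[OF q]) (simp add: \<alpha>(4))
    moreover have "c (t i) i \<in> s i" if "i < k" for i
      using c(1)[OF subsetD[OF T(1) t(1)[OF that]] that] t(2)[OF that] by simp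
    ultimately show "\<exists>a. (\<forall>i<k. a i \<in> s i) \<and> q a \<noteq> 0" by (intro exI[of _ "\<lambda>i. c (t i) i"]) simp
  qed
  from ex_maximal_generic[OF gen0] obtain Y where Y: "Y \<subseteq> \<Union>(V ` T)" "generic k q (V ` T) Y" and
    cov: "\<forall>W\<in>V ` T. \<exists>\<Phi>\<subseteq>slices k q. |\<Phi>| \<le>o |words (V ` T \<union> (\<lambda>y. {y}) ` Y) k \<times> {..<k}| \<and>
      (\<forall>f\<in>\<Phi>. \<exists>x\<in>W. f x \<noteq> 0) \<and> W \<subseteq> Y \<union> (\<Union>f\<in>\<Phi>. {x \<in> W. f x = 0})"
    by (elim exE conjE) (rule that)
  have YX: "Y \<subseteq> X" using Y(1) V(1) T(1) by blast
  have "|X| \<le>o |Y|"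
  proof (rule ccontr)
    assume "\<not> |X| \<le>o |Y|"
    then have Yless: "|Y| <o |X|" by (simp only: not_card_of_ordLeq)
    obtain D1 where D1: "D1 \<in> F" "|Y| <o |D1|" using Fcof[OF Yless] by blast
    have "\<exists>D\<in>T. D1 \<in> underS ?r D"
    proof (rule ccontr)
      assume no: "\<not> (\<exists>D\<in>T. D1 \<in> underS ?r D)"
      have "well_order_on F ?r" by (rule card_of_well_order_on)
      then have "T \<subseteq> underS ?r D1 \<union> {D1}"
        using no T(1) D1(1) unfolding well_order_on_def linear_order_on_def total_on_def underS_def by blast
      then have "|T| \<le>o |underS ?r D1 \<union> {D1}|" by (rule card_of_mono1)
      moreover have "|underS ?r D1 \<union> {D1}| <o |F|"
        using D1(1) Finf
        by (intro card_of_Un_ordLess_infinite card_of_underS card_of_Card_order finite_card_of_ordLess)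
          (simp_all add: Field_card_of)
      ultimately have "|T| <o |F|" by (rule ordLeq_ordLess_trans)
      then show False using T(2) not_card_of_ordLeq by blast
    qed
    then obtain D where D: "D \<in> T" "D1 \<in> underS ?r D" by blast
    then have DF: "D \<in> F" using T(1) by blast
    have "|Y| \<le>o |D1|" using D1(2) by (rule ordLess_imp_ordLeq)
    also have "|D1| \<le>o |S D|" using S(2)[OF DF D(2)] .
    also have "|S D| \<le>o |B D|" by (rule SB)
    finally have YB: "|Y| \<le>o |B D|" .
    have "|V ` T| \<le>o |T|" by (rule card_of_image)
    also have "|T| \<le>o |F|" using T(1) by (rule card_of_mono1)
    also have "|F| \<le>o |I|" by (rule I(3))
    also have "|I| \<le>o |B D|" by (rule IB)
    finally have "|V ` T| \<le>o |B D|" .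
    moreover have "|(\<lambda>y. {y}) ` Y| \<le>o |B D|" using card_of_image YB by (rule ordLeq_transitive)
    ultimately have "|V ` T \<union> (\<lambda>y. {y}) ` Y| \<le>o |B D|"
      using Binf[of D] by (intro card_of_Un_ordLeq)
    then have words: "|words (V ` T \<union> (\<lambda>y. {y}) ` Y) k \<times> {..<k}| \<le>o |B D|"
      using Binf[of D] finite_card_of_ordLess[of "{..<k}", OF _ Binf]
      by (intro card_of_Sigma_ordLeq_infinite card_of_words_ordLeq) (auto intro: ordLess_imp_ordLeq)
    from bspec[OF cov imageI[OF D(1)]] obtain \<Phi> where \<Phi>: "\<Phi> \<subseteq> slices k q"
      "|\<Phi>| \<le>o |words (V ` T \<union> (\<lambda>y. {y}) ` Y) k \<times> {..<k}|" "\<And>f. f \<in> \<Phi> \<Longrightarrow> \<exists>x\<in>V D. f x \<noteq> 0"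
      "V D \<subseteq> Y \<union> (\<Union>f\<in>\<Phi>. {x \<in> V D. f x = 0})"
      by (elim exE conjE) (rule that, auto)
    have "|\<Phi>| \<le>o |B D|" using \<Phi>(2) words by (rule ordLeq_transitive)
    moreover have "\<forall>f\<in>\<Phi>. |{x \<in> V D. f x = 0}| \<le>o |B D|" using V(3)[OF DF] \<Phi>(1,3) by blast
    ultimately have "|\<Union>f\<in>\<Phi>. {x \<in> V D. f x = 0}| \<le>o |B D|"
      using Binf[of D] by (intro card_of_UNION_ordLeq_infinite)
    then have "|Y \<union> (\<Union>f\<in>\<Phi>. {x \<in> V D. f x = 0})| \<le>o |B D|"
      using YB Binf[of D] by (intro card_of_Un_ordLeq)
    then have "|V D| \<le>o |B D|" by (rule ordLeq_transitive[OF card_of_mono1[OF \<Phi>(4)]])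
    then show False using V(2)[OF DF] not_card_of_ordLeq by blast
  qed
  then show ?thesis using YX generic_nonzero[OF Y(2) q] by blast
qed

lemma large_generic_subset:
  assumes "q \<in> sep k G" "0 < k" "infinite X"
    and "\<And>A. A \<subseteq> X \<Longrightarrow> infinite A \<Longrightarrow> \<exists>a. (\<forall>i<k. a i \<in> A) \<and> q a \<noteq> 0"
  shows "\<exists>Y\<subseteq>X. |X| \<le>o |Y| \<and> (\<forall>a. inj_on a {..<k} \<and> a ` {..<k} \<subseteq> Y \<longrightarrow> q a \<noteq> 0)"
  using large_generic_subset_regular[OF assms(1,3)] large_generic_subset_singular[OF assms(1-3)] assms(4) by blast

section \<open>Polynomials of bounded degree in each variable\<close>

definition mono_fun :: "nat \<Rightarrow> (nat \<Rightarrow> nat) \<Rightarrow> (nat \<Rightarrow> real) \<Rightarrow> real" where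
  "mono_fun n e x = (\<Prod>i<n. x i ^ e i)"

definition box_mono :: "nat \<Rightarrow> nat \<Rightarrow> ((nat \<Rightarrow> real) \<Rightarrow> real) set" where
  "box_mono n d = mono_fun n ` ({..<n} \<rightarrow>\<^sub>E {..d})"

definition box_poly :: "nat \<Rightarrow> nat \<Rightarrow> ((nat \<Rightarrow> real) \<Rightarrow> real) set" where
  "box_poly n d = fspan (box_mono n d)"

lemma finite_box_mono: "finite (box_mono n d)"
  unfolding box_mono_def by (intro finite_imageI finite_PiE) auto

lemma card_box_mono_le: "card (box_mono n d) \<le> Suc d ^ n"
proof -
  have "card (box_mono n d) \<le> card ({..<n} \<rightarrow>\<^sub>E {..d})"
    unfolding box_mono_def by (intro card_image_le finite_PiE) auto
  then show ?thesis by (simp add: card_PiE)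
qed

lemma mono_fun_in_box_mono:
  assumes "\<And>i. i < n \<Longrightarrow> e i \<le> d" shows "mono_fun n e \<in> box_mono n d"
proof -
  have "mono_fun n e = mono_fun n (restrict e {..<n})"
    by (auto simp: mono_fun_def intro!: prod.cong)
  then show ?thesis using assms unfolding box_mono_def by auto
qed

lemma box_monoE:
  assumes "f \<in> box_mono n d" obtains e where "f = mono_fun n e" "\<And>i. i < n \<Longrightarrow> e i \<le> d"
  using assms unfolding box_mono_def by (auto simp: PiE_iff)

lemma mono_fun_box_poly: "(\<And>i. i < n \<Longrightarrow> e i \<le> d) \<Longrightarrow> mono_fun n e \<in> box_poly n d"
  unfolding box_poly_def by (intro fspan_superset finite_box_mono mono_fun_in_box_mono)

lemma mono_fun_add: "mono_fun n e x * mono_fun n e' x = mono_fun n (\<lambda>i. e i + e' i) x"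
  by (simp add: mono_fun_def power_add prod.distrib)

lemma box_poly_mono:
  assumes "d \<le> d'" shows "box_poly n d \<subseteq> box_poly n d'"
  unfolding box_poly_def
proof (rule fspan_mono[OF finite_box_mono])
  show "box_mono n d \<subseteq> box_mono n d'"
    using assms by (auto elim!: box_monoE intro!: mono_fun_in_box_mono intro: le_trans)
qed

lemma box_poly_const: "(\<lambda>x. c) \<in> box_poly n d"
proof -
  have "(\<lambda>x. c * mono_fun n (\<lambda>i. 0) x) \<in> box_poly n d"
    unfolding box_poly_def by (intro fspan_cmult fspan_superset finite_box_mono mono_fun_in_box_mono) auto
  then show ?thesis by (simp add: mono_fun_def)
qed

lemma box_poly_var:
  assumes "i < n" shows "(\<lambda>x. x i) \<in> box_poly n 1"
proof -
  have "mono_fun n (\<lambda>j. if j = i then 1 else 0) = (\<lambda>x. x i)"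
    using assms by (auto simp: mono_fun_def fun_eq_iff prod.remove[of _ i] intro!: prod.neutral)
  then show ?thesis using mono_fun_box_poly[of n "\<lambda>j. if j = i then 1 else 0" 1] by simp
qed

lemma box_poly_add: "f \<in> box_poly n d \<Longrightarrow> g \<in> box_poly n d \<Longrightarrow> (\<lambda>x. f x + g x) \<in> box_poly n d"
  unfolding box_poly_def by (rule fspan_add)

lemma box_poly_sum: "(\<And>i. i \<in> I \<Longrightarrow> f i \<in> box_poly n d) \<Longrightarrow> (\<lambda>x. \<Sum>i\<in>I. f i x) \<in> box_poly n d"
  unfolding box_poly_def by (rule fspan_sum)

lemma box_poly_mult:
  assumes f: "f \<in> box_poly n d" and g: "g \<in> box_poly n d'"
  shows "(\<lambda>x. f x * g x) \<in> box_poly n (d + d')"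
proof -
  obtain b where b: "\<And>x. f x = (\<Sum>t\<in>box_mono n d. b t * t x)"
    by (rule fspanE[OF f[unfolded box_poly_def]]) (rule that)
  obtain c where c: "\<And>x. g x = (\<Sum>t\<in>box_mono n d'. c t * t x)"
    by (rule fspanE[OF g[unfolded box_poly_def]]) (rule that)
  have "f x * g x = (\<Sum>s\<in>box_mono n d. \<Sum>t\<in>box_mono n d'. (b s * c t) * (s x * t x))" for x
    unfolding b c sum_product by (intro sum.cong refl) simp
  moreover have "(\<lambda>x. \<Sum>s\<in>box_mono n d. \<Sum>t\<in>box_mono n d'. (b s * c t) * (s x * t x)) \<in> box_poly n (d + d')"
  proof (intro box_poly_sum)
    fix s t assume "s \<in> box_mono n d" "t \<in> box_mono n d'"
    then have "(\<lambda>x. s x * t x) \<in> box_poly n (d + d')"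
      by (auto elim!: box_monoE simp: mono_fun_add intro!: mono_fun_box_poly add_mono)
    then show "(\<lambda>x. (b s * c t) * (s x * t x)) \<in> box_poly n (d + d')"
      unfolding box_poly_def by (rule fspan_cmult)
  qed
  ultimately show ?thesis by simp
qed

lemma box_poly_power:
  assumes "f \<in> box_poly n d" shows "(\<lambda>x. f x ^ m) \<in> box_poly n (m * d)"
proof (induction m)
  case (Suc m)
  then show ?case using box_poly_mult[OF assms Suc] by (simp add: add.commute)
qed (simp add: box_poly_const)

lemma box_poly_prod:
  assumes "finite I" "\<And>i. i \<in> I \<Longrightarrow> f i \<in> box_poly n d"
  shows "(\<lambda>x. \<Prod>i\<in>I. f i x) \<in> box_poly n (card I * d)"
  using assms
proof (induction I rule: finite_induct)
  case (insert i I)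
  then show ?case using box_poly_mult[of "f i" n d "\<lambda>x. \<Prod>i\<in>I. f i x" "card I * d"] by simp
qed (simp add: box_poly_const)

lemma poly_fun_imp_box_poly:
  assumes "f \<in> poly_fun {..<n}" shows "\<exists>d. f \<in> box_poly n d"
  using assms
proof induction
  case (const c) then show ?case using box_poly_const by blast
next
  case (var v) then show ?case using box_poly_var by blast
next
  case (add p q)
  then obtain d d' where "p \<in> box_poly n d" "q \<in> box_poly n d'" by blast
  then have "p \<in> box_poly n (max d d')" "q \<in> box_poly n (max d d')"
    using box_poly_mono[of d "max d d'" n] box_poly_mono[of d' "max d d'" n] by auto
  then show ?case using box_poly_add by blast
next
  case (mult p q) then show ?case using box_poly_mult by blast
qed

lemma mono_fun_has_derivative:
  assumes j: "j < n"
  shows "((\<lambda>t. mono_fun n e (x(j := t))) has_real_derivative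
     real (e j) * mono_fun n (e(j := e j - 1)) (x(j := t))) (at t)"
proof -
  have split: "mono_fun n e' (x(j := t)) = t ^ e' j * (\<Prod>i\<in>{..<n} - {j}. x i ^ e' i)" for e' t
    using j by (simp add: mono_fun_def prod.remove[of _ j])
  have "(\<Prod>i\<in>{..<n} - {j}. x i ^ (e(j := e j - 1)) i) = (\<Prod>i\<in>{..<n} - {j}. x i ^ e i)"
    by (intro prod.cong) auto
  then show ?thesis unfolding split by (auto intro!: derivative_eq_intros)
qed

lemma box_poly_has_derivative:
  assumes f: "f \<in> box_poly n d" and j: "j < n"
  shows "\<exists>g\<in>box_poly n d. \<forall>x t. ((\<lambda>t. f (x(j := t))) has_real_derivative g (x(j := t))) (at t)"
proof -
  obtain c where c: "\<And>x. f x = (\<Sum>m\<in>box_mono n d. c m * m x)"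
    by (rule fspanE[OF f[unfolded box_poly_def]]) (rule that)
  have "\<exists>g. g \<in> box_poly n d \<and> (\<forall>x t. ((\<lambda>t. m (x(j := t))) has_real_derivative g (x(j := t))) (at t))"
    if m: "m \<in> box_mono n d" for m
  proof -
    obtain e where e: "m = mono_fun n e" "\<And>i. i < n \<Longrightarrow> e i \<le> d" by (rule box_monoE[OF m]) (rule that)
    have "mono_fun n (e(j := e j - 1)) \<in> box_poly n d"
    proof (rule mono_fun_box_poly)
      fix i assume "i < n" then show "(e(j := e j - 1)) i \<le> d" using e(2)[of i] by auto
    qed
    then have "(\<lambda>x. real (e j) * mono_fun n (e(j := e j - 1)) x) \<in> box_poly n d"
      unfolding box_poly_def by (rule fspan_cmult)
    then show ?thesis using mono_fun_has_derivative[OF j] unfolding e(1)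
      by (intro exI[of _ "\<lambda>x. real (e j) * mono_fun n (e(j := e j - 1)) x"]) blast
  qed
  then have "\<forall>m\<in>box_mono n d. \<exists>g. g \<in> box_poly n d \<and>
      (\<forall>x t. ((\<lambda>t. m (x(j := t))) has_real_derivative g (x(j := t))) (at t))" by blast
  from bchoice[OF this] obtain D where D: "\<And>m. m \<in> box_mono n d \<Longrightarrow> D m \<in> box_poly n d"
    "\<And>m x t. m \<in> box_mono n d \<Longrightarrow> ((\<lambda>t. m (x(j := t))) has_real_derivative D m (x(j := t))) (at t)"
    by blast
  have "(\<lambda>x. \<Sum>m\<in>box_mono n d. c m * D m x) \<in> box_poly n d"
    using D(1) by (intro box_poly_sum) (auto simp: box_poly_def intro!: fspan_cmult)
  moreover have "((\<lambda>t. \<Sum>m\<in>box_mono n d. c m * m (x(j := t))) has_real_derivative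
      (\<Sum>m\<in>box_mono n d. c m * D m (x(j := t)))) (at t)" for x t
    by (intro DERIV_sum DERIV_cmult D(2))
  ultimately show ?thesis unfolding c
    by (intro bexI[of _ "\<lambda>x. \<Sum>m\<in>box_mono n d. c m * D m x"]) auto
qed

lemma continuous_on_box_poly:
  assumes "f \<in> box_poly n d" shows "continuous_on UNIV f"
proof -
  obtain c where c: "\<And>x. f x = (\<Sum>m\<in>box_mono n d. c m * m x)"
    by (rule fspanE[OF assms[unfolded box_poly_def]]) (rule that)
  have "continuous_on UNIV m" if "m \<in> box_mono n d" for m
    using that by (auto elim!: box_monoE simp: mono_fun_def[abs_def] intro!: continuous_intros)
  then have "continuous_on UNIV (\<lambda>x. \<Sum>m\<in>box_mono n d. c m * m x)"
    by (intro continuous_intros) auto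
  moreover have "f = (\<lambda>x. \<Sum>m\<in>box_mono n d. c m * m x)" using c by (rule ext)
  ultimately show ?thesis by simp
qed

section \<open>Isolated zeros of a nonnegative polynomial\<close>

lemma ex_algebraic_relation:
  assumes g: "\<And>i. i < n \<Longrightarrow> g i \<in> box_poly n d" and j: "j < n" and M: "M = (n * d + 1) ^ n"
  shows "\<exists>u. (\<exists>s\<le>M. \<exists>t\<in>{..<n} \<rightarrow>\<^sub>E {..M}. u s t \<noteq> (0::real)) \<and>
    (\<forall>x. (\<Sum>s\<le>M. (\<Sum>t\<in>{..<n} \<rightarrow>\<^sub>E {..M}. u s t * (\<Prod>i<n. g i x ^ t i)) * x j ^ s) = 0)"
proof -
  let ?E = "{..<n} \<rightarrow>\<^sub>E {..M}"
  let ?I = "{..M} \<times> ?E"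
  let ?T = "box_mono n (M + n * (M * d))"
  define F where "F = (\<lambda>(s, t) x. x j ^ s * (\<Prod>i<n. g i x ^ t i))"
  have finE: "finite ?E" by (intro finite_PiE) auto
  have "F p \<in> fspan ?T" if "p \<in> ?I" for p
  proof -
    obtain s t where p: "p = (s, t)" "s \<le> M" "t \<in> ?E" using \<open>p \<in> ?I\<close> by auto
    have "(\<lambda>x. x j ^ s) \<in> box_poly n M"
      using box_poly_power[OF box_poly_var[OF j], of s] box_poly_mono[of s M n] p(2) by auto
    moreover have "(\<lambda>x. g i x ^ t i) \<in> box_poly n (M * d)" if "i < n" for i
    proof -
      have "t i \<le> M" using p(3) that by (auto simp: PiE_iff)
      then show ?thesis
        using box_poly_power[OF g[OF that], of "t i"] box_poly_mono[of "t i * d" "M * d" n] by auto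
    qed
    then have "(\<lambda>x. \<Prod>i<n. g i x ^ t i) \<in> box_poly n (n * (M * d))"
      using box_poly_prod[of "{..<n}" "\<lambda>i x. g i x ^ t i" n "M * d"] by simp
    ultimately show ?thesis
      unfolding p(1) F_def prod.case box_poly_def[symmetric] by (rule box_poly_mult)
  qed
  then have "\<forall>p\<in>?I. \<exists>c. \<forall>x. F p x = (\<Sum>m\<in>?T. c m * m x)" by (auto simp: fspan_def)
  from bchoice[OF this] obtain c where c: "\<And>p x. p \<in> ?I \<Longrightarrow> F p x = (\<Sum>m\<in>?T. c p m * m x)"
    by blast
  have "card ?T \<le> Suc (M + n * (M * d)) ^ n" by (rule card_box_mono_le)
  also have "Suc (M + n * (M * d)) \<le> (n * d + 1) * Suc M" by (simp add: algebra_simps)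
  then have "Suc (M + n * (M * d)) ^ n \<le> ((n * d + 1) * Suc M) ^ n" by (rule power_mono) simp
  also have "((n * d + 1) * Suc M) ^ n = M * Suc M ^ n" by (simp only: power_mult_distrib M)
  also have "M * Suc M ^ n < Suc M * Suc M ^ n" by simp
  also have "Suc M * Suc M ^ n = card ?I" by (simp add: card_cartesian_product card_PiE)
  finally have "card ?T < card ?I" by simp
  from homogeneous_system[OF finite_box_mono _ this, of "\<lambda>m p. c p m"] finE
  obtain u where u: "\<exists>p\<in>?I. u p \<noteq> 0" "\<And>m. m \<in> ?T \<Longrightarrow> (\<Sum>p\<in>?I. c p m * u p) = 0" by auto
  have "(\<Sum>s\<le>M. (\<Sum>t\<in>?E. u (s, t) * (\<Prod>i<n. g i x ^ t i)) * x j ^ s) = 0" for x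
  proof -
    have "(\<Sum>s\<le>M. (\<Sum>t\<in>?E. u (s, t) * (\<Prod>i<n. g i x ^ t i)) * x j ^ s)
        = (\<Sum>s\<le>M. \<Sum>t\<in>?E. u (s, t) * F (s, t) x)"
      by (rule sum.cong[OF refl], subst sum_distrib_right) (simp add: F_def mult_ac)
    also have "\<dots> = (\<Sum>p\<in>?I. u p * F p x)"
      by (subst sum.cartesian_product) (simp only: case_prod_unfold prod.collapse)
    also have "\<dots> = (\<Sum>p\<in>?I. \<Sum>m\<in>?T. c p m * u p * m x)"
      by (intro sum.cong refl) (simp add: c sum_distrib_left mult_ac)
    also have "\<dots> = (\<Sum>m\<in>?T. (\<Sum>p\<in>?I. c p m * u p) * m x)"
      by (subst sum.swap) (simp add: sum_distrib_right)
    also have "\<dots> = 0" using u(2) by simp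
    finally show ?thesis .
  qed
  then show ?thesis using u(1) by (intro exI[of _ "\<lambda>s t. u (s, t)"]) auto
qed

lemma digits_inj:
  fixes t t' :: "nat \<Rightarrow> nat"
  assumes "\<And>i. i < n \<Longrightarrow> t i < B" "\<And>i. i < n \<Longrightarrow> t' i < B"
    and "(\<Sum>i<n. B ^ i * t i) = (\<Sum>i<n. B ^ i * t' i)" "i < n"
  shows "t i = t' i"
  using assms
proof (induction n arbitrary: t t' i)
  case (Suc n)
  have split: "(\<Sum>i<Suc n. B ^ i * s i) = s 0 + B * (\<Sum>i<n. B ^ i * s (Suc i))" for s :: "nat \<Rightarrow> nat"
    by (subst sum.lessThan_Suc_shift) (simp add: sum_distrib_left mult.assoc)
  have eq: "t 0 + B * (\<Sum>i<n. B ^ i * t (Suc i)) = t' 0 + B * (\<Sum>i<n. B ^ i * t' (Suc i))"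
    using Suc.prems(3) unfolding split .
  have B: "t 0 < B" "t' 0 < B" using Suc.prems(1,2) by auto
  have "t 0 = t' 0" using arg_cong[OF eq, of "\<lambda>x. x mod B"] B by simp
  moreover have "t (Suc i) = t' (Suc i)" if "i < n" for i
  proof (rule Suc.IH[OF _ _ _ that])
    show "(\<Sum>i<n. B ^ i * t (Suc i)) = (\<Sum>i<n. B ^ i * t' (Suc i))"
      using eq \<open>t 0 = t' 0\<close> B by simp
  qed (use Suc.prems in auto)
  ultimately show ?case using Suc.prems(4) by (cases i) auto
qed simp

text \<open>Along the curve \<open>a\<^sub>i = \<epsilon>^(B^i)\<close> distinct monomials with exponents below \<open>B\<close> become
  distinct powers of \<open>\<epsilon>\<close>.\<close>
lemma finite_zeros_on_curve:
  fixes u :: "(nat \<Rightarrow> nat) \<Rightarrow> real"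
  assumes "t0 \<in> {..<n} \<rightarrow>\<^sub>E {..K}" "u t0 \<noteq> 0"
  shows "finite {\<epsilon>. (\<Sum>t\<in>{..<n} \<rightarrow>\<^sub>E {..K}. u t * (\<Prod>i<n. (\<epsilon> ^ (Suc K ^ i)) ^ t i)) = 0}"
proof -
  let ?E = "{..<n} \<rightarrow>\<^sub>E {..K}"
  define w where "w t = (\<Sum>i<n. Suc K ^ i * t i)" for t :: "nat \<Rightarrow> nat"
  have winj: "t = t'" if "t \<in> ?E" "t' \<in> ?E" "w t = w t'" for t t'
  proof (rule PiE_ext[OF that(1,2)])
    fix i assume "i \<in> {..<n}"
    then show "t i = t' i"
      using digits_inj[of n t "Suc K" t' i] that by (auto simp: w_def PiE_iff less_Suc_eq_le)
  qed
  define p where "p = (\<Sum>t\<in>?E. Polynomial.monom (u t) (w t))"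
  have fin: "finite ?E" by (intro finite_PiE) auto
  have "coeff p (w t0) = (\<Sum>t\<in>?E. if t = t0 then u t else 0)"
    unfolding p_def coeff_sum using winj[OF _ assms(1)] by (intro sum.cong) auto
  also have "\<dots> = u t0" using assms(1) fin by simp
  finally have "p \<noteq> 0" using assms(2) by auto
  then have "finite {\<epsilon>. poly p \<epsilon> = 0}" by (rule poly_roots_finite)
  moreover have "poly p \<epsilon> = (\<Sum>t\<in>?E. u t * (\<Prod>i<n. (\<epsilon> ^ (Suc K ^ i)) ^ t i))" for \<epsilon>
    unfolding p_def poly_sum poly_monom w_def
    by (simp add: power_sum power_mult del: power_Suc)
  ultimately show ?thesis by simp
qed

lemma few_critical_points:
  assumes g: "\<And>i. i < n \<Longrightarrow> g i \<in> box_poly n d" and "0 < \<delta>"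
  shows "\<exists>a. (\<forall>i<n. \<bar>a i\<bar> < \<delta>) \<and> finite {y \<in> Rn n. \<forall>i<n. g i y = a i}
    \<and> card {y \<in> Rn n. \<forall>i<n. g i y = a i} \<le> ((n * d + 1) ^ n) ^ n"
proof -
  define M where "M = (n * d + 1) ^ n"
  let ?E = "{..<n} \<rightarrow>\<^sub>E {..M}"
  have "\<forall>j\<in>{..<n}. \<exists>u. (\<exists>s\<le>M. \<exists>t\<in>?E. u s t \<noteq> (0::real)) \<and>
    (\<forall>x. (\<Sum>s\<le>M. (\<Sum>t\<in>?E. u s t * (\<Prod>i<n. g i x ^ t i)) * x j ^ s) = 0)"
    using ex_algebraic_relation[OF g _ M_def] by auto
  from bchoice[OF this] obtain u :: "nat \<Rightarrow> nat \<Rightarrow> (nat \<Rightarrow> nat) \<Rightarrow> real" where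
    u1: "\<And>j. j < n \<Longrightarrow> \<exists>s\<le>M. \<exists>t\<in>?E. u j s t \<noteq> 0" and
    u2: "\<And>j x. j < n \<Longrightarrow> (\<Sum>s\<le>M. (\<Sum>t\<in>?E. u j s t * (\<Prod>i<n. g i x ^ t i)) * x j ^ s) = 0"
    by auto
  have "\<forall>j\<in>{..<n}. \<exists>s. s \<le> M \<and> (\<exists>t\<in>?E. u j s t \<noteq> 0)" using u1 by auto
  from bchoice[OF this] obtain s where s: "\<And>j. j < n \<Longrightarrow> s j \<le> M" "\<And>j. j < n \<Longrightarrow> \<exists>t\<in>?E. u j (s j) t \<noteq> 0"
    by auto
  let ?bad = "\<lambda>j. {\<epsilon>. (\<Sum>t\<in>?E. u j (s j) t * (\<Prod>i<n. (\<epsilon> ^ (Suc M ^ i)) ^ t i)) = 0}"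
  have "finite (?bad j)" if "j < n" for j
    using s(2)[OF that] finite_zeros_on_curve[of _ n M "u j (s j)"] by auto
  then have "finite (\<Union>j\<in>{..<n}. ?bad j)" by (intro finite_UN_I) auto
  moreover have "infinite {0<..<min \<delta> 1}" using \<open>0 < \<delta>\<close> by (intro infinite_Ioo) auto
  ultimately have "infinite ({0<..<min \<delta> 1} - (\<Union>j\<in>{..<n}. ?bad j))" by (rule Diff_infinite_finite)
  from infinite_imp_nonempty[OF this]
  obtain \<epsilon> where "\<epsilon> \<in> {0<..<min \<delta> 1} - (\<Union>j\<in>{..<n}. ?bad j)" by (subst (asm) ex_in_conv[symmetric]) (rule exE)
  then have \<epsilon>: "0 < \<epsilon>" "\<epsilon> < \<delta>" "\<epsilon> < 1" "\<And>j. j < n \<Longrightarrow> \<epsilon> \<notin> ?bad j" by auto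
  define a where "a i = \<epsilon> ^ (Suc M ^ i)" for i
  have "\<bar>a i\<bar> < \<delta>" for i
  proof -
    have "\<epsilon> ^ (Suc M ^ i) \<le> \<epsilon> ^ 1" using \<epsilon> by (intro power_decreasing) auto
    then show ?thesis using \<epsilon> by (simp add: a_def)
  qed
  moreover
  define b where "b j s = (\<Sum>t\<in>?E. u j s t * (\<Prod>i<n. a i ^ t i))" for j s
  define R where "R j = {z. (\<Sum>s\<le>M. b j s * z ^ s) = 0}" for j
  have "b j (s j) \<noteq> 0" if "j < n" for j using \<epsilon>(4)[OF that] by (simp add: b_def a_def)
  then have R: "finite (R j)" "card (R j) \<le> M" if "j < n" for j
    using Transcendental.polyfun_rootbound[where c = "b j" and k = "s j" and n = M] s(1) that by (auto simp: R_def)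
  let ?C = "{y \<in> Rn n. \<forall>i<n. g i y = a i}"
  have inR: "y j \<in> R j" if "y \<in> ?C" "j < n" for y j
    using u2[where j = j and x = y, OF that(2)] that(1) by (simp add: R_def b_def)
  have inj: "inj_on (\<lambda>y. restrict y {..<n}) ?C"
  proof (rule inj_onI, rule ext)
    fix y y' i assume y: "y \<in> ?C" "y' \<in> ?C" "restrict y {..<n} = restrict y' {..<n}"
    show "y i = y' i"
    proof (cases "i < n")
      case True
      then show ?thesis using fun_cong[OF y(3), of i] by simp
    next
      case False
      then show ?thesis using y(1,2) by (simp add: Rn_def)
    qed
  qed
  have sub: "(\<lambda>y. restrict y {..<n}) ` ?C \<subseteq> Pi\<^sub>E {..<n} R"
    by (intro image_subsetI) (simp add: restrict_PiE_iff inR)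
  have finP: "finite (Pi\<^sub>E {..<n} R)" using R(1) by (intro finite_PiE) auto
  have "finite ?C" by (rule finite_imageD[OF finite_subset[OF sub finP] inj])
  moreover have "card ?C \<le> M ^ n"
  proof -
    have "card ?C \<le> card (Pi\<^sub>E {..<n} R)" using inj sub finP by (rule card_inj_on_le)
    also have "\<dots> = (\<Prod>j<n. card (R j))" by (simp add: card_PiE)
    also have "\<dots> \<le> (\<Prod>j<n. M)" using R(2) by (intro prod_mono) auto
    finally show ?thesis by simp
  qed
  ultimately show ?thesis by (intro exI[of _ a]) (simp add: M_def)
qed

lemma compact_Pi_UNIV:
  fixes S :: "nat \<Rightarrow> real set"
  assumes "\<And>i. compact (S i)"
  shows "compact {x. \<forall>i. x i \<in> S i}"
proof -
  have "compactin (product_topology (\<lambda>i. euclidean) UNIV) (PiE UNIV S)"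
    using assms by (simp add: compactin_PiE)
  then have "compact (PiE UNIV S)" by (simp add: euclidean_product_topology)
  moreover have "PiE UNIV S = {x. \<forall>i. x i \<in> S i}" by auto
  ultimately show ?thesis by simp
qed

lemma closed_Rn: "closed (Rn n)"
proof -
  have "closed {x::nat \<Rightarrow> real. i \<ge> n \<longrightarrow> x i = 0}" for i
    by (cases "i \<ge> n") (auto intro!: closed_Collect_eq continuous_intros)
  then have "closed (\<Inter>i. {x::nat \<Rightarrow> real. i \<ge> n \<longrightarrow> x i = 0})" by (intro closed_INT) auto
  moreover have "Rn n = (\<Inter>i. {x::nat \<Rightarrow> real. i \<ge> n \<longrightarrow> x i = 0})" by (auto simp: Rn_def)
  ultimately show ?thesis by simp
qed

definition cube :: "nat \<Rightarrow> (nat \<Rightarrow> real) \<Rightarrow> real \<Rightarrow> (nat \<Rightarrow> real) set" where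
  "cube n z r = {y \<in> Rn n. \<forall>i<n. \<bar>y i - z i\<bar> \<le> r}"

lemma compact_cube: "compact (cube n z r)"
proof -
  have "cube n z r = {y. \<forall>i. y i \<in> (if i < n then {z i - r..z i + r} else {0})}"
    by (auto simp: cube_def Rn_def abs_le_iff not_less[symmetric] split: if_splits)
  then show ?thesis using compact_Pi_UNIV[of "\<lambda>i. if i < n then {z i - r..z i + r} else {0}"] by simp
qed

lemma ex_gradient_near_isolated_zero:
  assumes f: "f \<in> box_poly n d" and nonneg: "\<And>x. x \<in> Rn n \<Longrightarrow> 0 \<le> f x"
    and g: "\<And>i x t. i < n \<Longrightarrow> ((\<lambda>t. f (x(i := t))) has_real_derivative g i (x(i := t))) (at t)"
    and z: "z \<in> Rn n" "f z = 0" and r: "0 < r"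
    and iso: "\<And>y. y \<in> cube n z r \<Longrightarrow> f y = 0 \<Longrightarrow> y = z"
  shows "\<exists>\<delta>>0. \<forall>a. (\<forall>i<n. \<bar>a i\<bar> < \<delta>) \<longrightarrow>
    (\<exists>y\<in>Rn n. (\<forall>i<n. \<bar>y i - z i\<bar> < r) \<and> (\<forall>i<n. g i y = a i))"
proof -
  let ?K = "cube n z r"
  let ?S = "{y \<in> ?K. \<exists>i<n. \<bar>y i - z i\<bar> = r}"
  have contf: "continuous_on A f" for A
    using continuous_on_subset[OF continuous_on_box_poly[OF f]] by blast
  have zK: "z \<in> ?K" using z r by (simp add: cube_def)
  have "\<exists>c>0. \<forall>y\<in>?S. c \<le> f y"
  proof (cases "?S = {}")
    case True
    show ?thesis by (rule exI[of _ 1]) (simp add: True)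
  next
    case False
    have "closed (\<Union>i<n. {y. \<bar>y i - z i\<bar> = r})"
      by (intro closed_UN ballI closed_Collect_eq continuous_intros continuous_on_product_coordinates) auto
    then have "compact (?K \<inter> (\<Union>i<n. {y. \<bar>y i - z i\<bar> = r}))" by (rule compact_Int_closed[OF compact_cube])
    moreover have "?S = ?K \<inter> (\<Union>i<n. {y. \<bar>y i - z i\<bar> = r})" by auto
    ultimately have "compact ?S" by simp
    then obtain x where x: "x \<in> ?S" "\<And>y. y \<in> ?S \<Longrightarrow> f x \<le> f y"
      using continuous_attains_inf[OF _ False contf] by blast
    have "x \<noteq> z" using x(1) r by auto
    then have "f x \<noteq> 0" using iso[of x] x(1) by auto
    moreover have "x \<in> Rn n" using x(1) by (simp add: cube_def)
    ultimately have "0 < f x" using nonneg[of x] by simp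
    then show ?thesis using x(2) by (intro exI[of _ "f x"]) auto
  qed
  then obtain c where c: "0 < c" "\<And>y. y \<in> ?S \<Longrightarrow> c \<le> f y" by blast
  define \<delta> where "\<delta> = c / (real n * r + 1)"
  have "0 < real n * r + 1" using r by (intro add_nonneg_pos) auto
  then have \<delta>: "0 < \<delta>" "real n * (\<delta> * r) < c"
    using c(1) by (auto simp: \<delta>_def field_simps)
  have "\<exists>y\<in>Rn n. (\<forall>i<n. \<bar>y i - z i\<bar> < r) \<and> (\<forall>i<n. g i y = a i)" if a: "\<And>i. i < n \<Longrightarrow> \<bar>a i\<bar> < \<delta>" for a
  proof -
    define h where "h y = f y - (\<Sum>i<n. a i * (y i - z i))" for y
    have "continuous_on ?K h" unfolding h_def
      by (intro continuous_intros contf continuous_on_subset[OF continuous_on_product_coordinates]) auto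
    then obtain y where y: "y \<in> ?K" "\<And>x. x \<in> ?K \<Longrightarrow> h y \<le> h x"
      using continuous_attains_inf[OF compact_cube, of n z r h] zK by blast
    have "h y \<le> 0" using y(2)[OF zK] z(2) by (simp add: h_def)
    have "y \<notin> ?S"
    proof
      assume "y \<in> ?S"
      have "(\<Sum>i<n. a i * (y i - z i)) \<le> (\<Sum>i<n. \<delta> * r)"
      proof (rule sum_mono)
        fix i assume "i \<in> {..<n}"
        then have "\<bar>a i\<bar> \<le> \<delta>" "\<bar>y i - z i\<bar> \<le> r" using a[of i] y(1) by (auto simp: cube_def)
        then have "\<bar>a i\<bar> * \<bar>y i - z i\<bar> \<le> \<delta> * r" using \<delta>(1) by (intro mult_mono) auto
        then show "a i * (y i - z i) \<le> \<delta> * r" by (simp add: abs_mult[symmetric])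
      qed
      then have "h y > 0" using c(2)[OF \<open>y \<in> ?S\<close>] \<delta>(2) by (simp add: h_def)
      then show False using \<open>h y \<le> 0\<close> by simp
    qed
    then have inner: "\<bar>y i - z i\<bar> < r" if "i < n" for i
      using y(1) that by (force simp: cube_def)
    moreover have "g j y = a j" if j: "j < n" for j
    proof -
      have "((\<lambda>t. h (y(j := t))) has_real_derivative g j (y(j := t)) - a j) (at t)" for t
      proof -
        have eq: "(\<Sum>i<n. a i * ((y(j := t)) i - z i)) = a j * (t - z j) + (\<Sum>i\<in>{..<n} - {j}. a i * (y i - z i))" for t
          using j by (subst sum.remove[of _ j]) (auto intro!: sum.cong)
        show ?thesis unfolding h_def eq by (auto intro!: derivative_eq_intros g[OF j])
      qed
      from this[of "y j"] have D: "((\<lambda>t. h (y(j := t))) has_real_derivative g j y - a j) (at (y j))" by simp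
      have "g j y - a j = 0"
      proof (rule DERIV_local_min[OF D])
        show "0 < r - \<bar>y j - z j\<bar>" using inner[OF j] by simp
        show "\<forall>t. \<bar>y j - t\<bar> < r - \<bar>y j - z j\<bar> \<longrightarrow> h (y(j := y j)) \<le> h (y(j := t))"
        proof (intro allI impI)
          fix t assume t: "\<bar>y j - t\<bar> < r - \<bar>y j - z j\<bar>"
          have "y(j := t) \<in> ?K" using y(1) t j by (auto simp: cube_def Rn_def)
          then show "h (y(j := y j)) \<le> h (y(j := t))" using y(2) by simp
        qed
      qed
      then show ?thesis by simp
    qed
    ultimately show ?thesis using y(1) by (intro bexI[of _ y]) (auto simp: cube_def)
  qed
  then show ?thesis using \<delta>(1) by (intro exI[of _ \<delta>]) auto
qed

definition isolated_zeros :: "nat \<Rightarrow> ((nat \<Rightarrow> real) \<Rightarrow> real) \<Rightarrow> (nat \<Rightarrow> real) set" where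
  "isolated_zeros n f = {z \<in> Rn n. f z = 0 \<and> (\<exists>r>0. \<forall>y\<in>cube n z r. f y = 0 \<longrightarrow> y = z)}"

lemma few_isolated_zeros:
  assumes f: "f \<in> box_poly n d" and nonneg: "\<And>x. x \<in> Rn n \<Longrightarrow> 0 \<le> f x"
  shows "finite (isolated_zeros n f) \<and> card (isolated_zeros n f) \<le> ((n * d + 1) ^ n) ^ n"
proof (rule finite_if_finite_subsets_card_bdd)
  fix G assume G: "G \<subseteq> isolated_zeros n f" "finite G"
  have "\<forall>i\<in>{..<n}. \<exists>g. g \<in> box_poly n d \<and>
      (\<forall>x t. ((\<lambda>t. f (x(i := t))) has_real_derivative g (x(i := t))) (at t))"
    using box_poly_has_derivative[OF f] by blast
  from bchoice[OF this] obtain g where g: "\<And>i. i < n \<Longrightarrow> g i \<in> box_poly n d"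
    "\<And>i x t. i < n \<Longrightarrow> ((\<lambda>t. f (x(i := t))) has_real_derivative g i (x(i := t))) (at t)" by blast
  have "\<forall>z\<in>G. \<exists>r. 0 < r \<and> (\<forall>y\<in>cube n z r. f y = 0 \<longrightarrow> y = z)"
    using G(1) by (auto simp: isolated_zeros_def)
  from bchoice[OF this] obtain r where r: "\<And>z. z \<in> G \<Longrightarrow> 0 < r z"
    "\<And>z y. z \<in> G \<Longrightarrow> y \<in> cube n z (r z) \<Longrightarrow> f y = 0 \<Longrightarrow> y = z" by blast
  have Gz: "z \<in> Rn n" "f z = 0" if "z \<in> G" for z using that G(1) by (auto simp: isolated_zeros_def)
  have "\<exists>\<delta>>0. \<forall>a. (\<forall>i<n. \<bar>a i\<bar> < \<delta>) \<longrightarrow>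
      (\<exists>y\<in>Rn n. (\<forall>i<n. \<bar>y i - z i\<bar> < r z / 2) \<and> (\<forall>i<n. g i y = a i))" if z: "z \<in> G" for z
  proof (rule ex_gradient_near_isolated_zero[OF f nonneg g(2) Gz[OF z]])
    show "0 < r z / 2" using r(1)[OF z] by simp
    fix y assume "y \<in> cube n z (r z / 2)" "f y = 0"
    moreover from this have "y \<in> cube n z (r z)" using r(1)[OF z] by (force simp: cube_def)
    ultimately show "y = z" using r(2)[OF z] by blast
  qed
  then have "\<forall>z\<in>G. \<exists>\<delta>. 0 < \<delta> \<and> (\<forall>a. (\<forall>i<n. \<bar>a i\<bar> < \<delta>) \<longrightarrow>
      (\<exists>y\<in>Rn n. (\<forall>i<n. \<bar>y i - z i\<bar> < r z / 2) \<and> (\<forall>i<n. g i y = a i)))" by blast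
  from bchoice[OF this] obtain \<delta> where \<delta>: "\<And>z. z \<in> G \<Longrightarrow> 0 < \<delta> z"
    "\<And>z a. z \<in> G \<Longrightarrow> (\<And>i. i < n \<Longrightarrow> \<bar>a i\<bar> < \<delta> z) \<Longrightarrow>
      \<exists>y\<in>Rn n. (\<forall>i<n. \<bar>y i - z i\<bar> < r z / 2) \<and> (\<forall>i<n. g i y = a i)" by blast
  define \<delta>0 where "\<delta>0 = Min (insert 1 (\<delta> ` G))"
  have "0 < \<delta>0" "\<And>z. z \<in> G \<Longrightarrow> \<delta>0 \<le> \<delta> z" using G(2) \<delta>(1) by (auto simp: \<delta>0_def)
  obtain a where a: "\<And>i. i < n \<Longrightarrow> \<bar>a i\<bar> < \<delta>0" and C: "finite {y \<in> Rn n. \<forall>i<n. g i y = a i}"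
    "card {y \<in> Rn n. \<forall>i<n. g i y = a i} \<le> ((n * d + 1) ^ n) ^ n"
    using few_critical_points[where g = g, OF g(1) \<open>0 < \<delta>0\<close>] by blast
  have "\<forall>z\<in>G. \<exists>y. y \<in> Rn n \<and> (\<forall>i<n. \<bar>y i - z i\<bar> < r z / 2) \<and> (\<forall>i<n. g i y = a i)"
  proof
    fix z assume z: "z \<in> G"
    have "\<exists>y\<in>Rn n. (\<forall>i<n. \<bar>y i - z i\<bar> < r z / 2) \<and> (\<forall>i<n. g i y = a i)"
    proof (rule \<delta>(2)[OF z])
      show "\<bar>a i\<bar> < \<delta> z" if "i < n" for i
        using a[OF that] \<open>\<And>z. z \<in> G \<Longrightarrow> \<delta>0 \<le> \<delta> z\<close>[OF z] by linarith
    qed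
    then show "\<exists>y. y \<in> Rn n \<and> (\<forall>i<n. \<bar>y i - z i\<bar> < r z / 2) \<and> (\<forall>i<n. g i y = a i)" by blast
  qed
  from bchoice[OF this] obtain Y where Y: "\<And>z. z \<in> G \<Longrightarrow> Y z \<in> Rn n"
    "\<And>z i. z \<in> G \<Longrightarrow> i < n \<Longrightarrow> \<bar>Y z i - z i\<bar> < r z / 2" "\<And>z i. z \<in> G \<Longrightarrow> i < n \<Longrightarrow> g i (Y z) = a i" by blast
  have close: "z' = z" if z: "z \<in> G" "z' \<in> G" "Y z = Y z'" "r z' \<le> r z" for z z'
  proof (rule r(2)[OF z(1)])
    have "\<bar>z' i - z i\<bar> \<le> r z" if "i < n" for i
      using Y(2)[OF z(1) that, unfolded z(3)] Y(2)[OF z(2) that] z(4) by linarith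
    then show "z' \<in> cube n z (r z)" using Gz(1)[OF z(2)] by (simp add: cube_def)
    show "f z' = 0" using Gz(2)[OF z(2)] .
  qed
  have "inj_on Y G"
  proof (rule inj_onI)
    fix z z' assume "z \<in> G" "z' \<in> G" "Y z = Y z'"
    then show "z = z'" using close[of z z'] close[of z' z] linear[of "r z" "r z'"] by metis
  qed
  moreover have "Y ` G \<subseteq> {y \<in> Rn n. \<forall>i<n. g i y = a i}" using Y(1,3) by blast
  ultimately have "card G \<le> card {y \<in> Rn n. \<forall>i<n. g i y = a i}" using C(1) by (rule card_inj_on_le)
  then show "card G \<le> ((n * d + 1) ^ n) ^ n" using C(2) by (rule le_trans)
qed

lemma LIMSEQ_fun_iff:
  fixes X :: "nat \<Rightarrow> 'a \<Rightarrow> 'b::topological_space"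
  shows "X \<longlonglongrightarrow> x \<longleftrightarrow> (\<forall>i. (\<lambda>m. X m i) \<longlonglongrightarrow> x i)"
  using limitin_componentwise[of "\<lambda>i::'a. euclidean::'b topology" UNIV X x sequentially]
  by (simp add: euclidean_product_topology)

lemma in_derived_set_of_euclidean: "x \<in> euclidean derived_set_of S \<longleftrightarrow> x islimpt S"
  by (auto simp: in_derived_set_of islimpt_def)

lemma zero_set_card_dichotomy:
  assumes f: "f \<in> box_poly n d" and nonneg: "\<And>x. x \<in> Rn n \<Longrightarrow> 0 \<le> f x"
  defines "Z \<equiv> {x \<in> Rn n. f x = 0}"
  shows "finite Z \<and> card Z \<le> ((n * d + 1) ^ n) ^ n \<or> (UNIV::real set) \<lesssim> Z"
proof (cases "Z = isolated_zeros n f")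
  case True
  then show ?thesis using few_isolated_zeros[OF f nonneg] by simp
next
  case False
  let ?I = "isolated_zeros n f"
  let ?P = "Z - ?I"
  have I: "finite ?I" "?I \<subseteq> Z" using few_isolated_zeros[OF f nonneg] by (auto simp: isolated_zeros_def Z_def)
  have "closed (Rn n \<inter> {x. f x = 0})"
    by (intro closed_Int closed_Rn closed_Collect_eq continuous_on_box_poly[OF f] continuous_intros)
  then have closed: "closed Z" by (simp add: Z_def Int_def)
  have "x islimpt ?P \<longleftrightarrow> x \<in> ?P" for x
  proof
    assume x: "x islimpt ?P"
    then have "x islimpt Z" by (rule islimpt_subset) auto
    then have xZ: "x \<in> Z" using closed by (simp add: closed_limpt)
    have "x \<notin> ?I"
    proof
      assume "x \<in> ?I"
      then obtain r where r: "0 < r" "\<And>y. y \<in> cube n x r \<Longrightarrow> f y = 0 \<Longrightarrow> y = x"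
        by (auto simp: isolated_zeros_def)
      have "open (\<Inter>i<n. {y. \<bar>y i - x i\<bar> < r})"
        by (intro open_INT ballI open_Collect_less continuous_intros) auto
      moreover have "x \<in> (\<Inter>i<n. {y. \<bar>y i - x i\<bar> < r})" using r(1) by auto
      ultimately obtain y where y: "y \<in> ?P" "y \<in> (\<Inter>i<n. {y. \<bar>y i - x i\<bar> < r})" "y \<noteq> x"
        using x unfolding islimpt_def by meson
      then have "y \<in> cube n x r" by (auto simp: cube_def Z_def less_imp_le)
      then show False using r(2)[of y] y by (auto simp: Z_def)
    qed
    then show "x \<in> ?P" using xZ by simp
  next
    assume x: "x \<in> ?P"
    have "\<exists>y. y \<in> cube n x (inverse (real (Suc m))) \<and> f y = 0 \<and> y \<noteq> x" for m
    proof -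
      have "0 < inverse (real (Suc m))" by simp
      then show ?thesis using x unfolding isolated_zeros_def Z_def by blast
    qed
    then obtain X where X: "\<And>m. X m \<in> cube n x (inverse (real (Suc m)))" "\<And>m. f (X m) = 0" "\<And>m. X m \<noteq> x"
      by metis
    have "(\<lambda>m. X m i) \<longlonglongrightarrow> x i" for i
    proof (cases "i < n")
      case True
      have "(\<lambda>m. X m i - x i) \<longlonglongrightarrow> 0"
      proof (rule Lim_null_comparison[OF _ LIMSEQ_inverse_real_of_nat])
        show "\<forall>\<^sub>F m in sequentially. norm (X m i - x i) \<le> inverse (real (Suc m))"
          using X(1) True by (simp add: cube_def)
      qed
      then show ?thesis by (rule LIM_zero_cancel)
    next
      case False
      then have "X m i = x i" for m using X(1)[of m] x by (simp add: cube_def Rn_def Z_def)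
      then show ?thesis by simp
    qed
    then have "X \<longlonglongrightarrow> x" by (simp add: LIMSEQ_fun_iff)
    moreover have "X m \<in> Z - {x}" for m using X by (auto simp: Z_def cube_def)
    ultimately have "x islimpt Z" unfolding islimpt_sequential by blast
    moreover have "Z = ?I \<union> ?P" using I(2) by blast
    ultimately show "x islimpt ?P" using islimpt_Un_finite[OF I(1), of x ?P] by simp
  qed
  then have "euclidean derived_set_of ?P = ?P"
    by (intro set_eqI) (simp only: in_derived_set_of_euclidean)
  moreover have "?P \<noteq> {}" using False I(2) by blast
  ultimately have "(UNIV::real set) \<lesssim> ?P"
    using lepoll_perfect_set[of "euclidean :: (nat \<Rightarrow> real) topology" ?P] completely_metrizable_space_euclidean by blast
  then show ?thesis using lepoll_trans[OF _ subset_imp_lepoll[of ?P Z]] by blast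
qed

section \<open>Complete and independent sets\<close>

lemma zclosure_product_zero:
  assumes zero: "\<And>a. (\<And>i. i < k \<Longrightarrow> a i \<in> A i) \<Longrightarrow> q a = 0"
    and B: "\<And>i. i < k \<Longrightarrow> B i \<subseteq> zclosure (slices k q) (A i)"
    and a: "\<And>i. i < k \<Longrightarrow> a i \<in> B i"
  shows "q a = 0"
proof -
  have "q a = 0" if "m \<le> k" "\<And>i. i < m \<Longrightarrow> a i \<in> B i" "\<And>i. m \<le> i \<Longrightarrow> i < k \<Longrightarrow> a i \<in> A i" for m a
    using that
  proof (induction m arbitrary: a)
    case 0
    then show ?case by (intro zero) auto
  next
    case (Suc m)
    then have m: "m < k" by simp
    have fA: "q (a(m := x)) = 0" if "x \<in> A m" for x
    proof (rule Suc.IH)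
      show "(a(m := x)) i \<in> A i" if "m \<le> i" "i < k" for i
        using Suc.prems(3)[of i] that \<open>x \<in> A m\<close> by (cases "i = m") auto
    qed (use Suc.prems in auto)
    have "a m \<in> zclosure (slices k q) (A m)" using Suc.prems(2)[of m] B[OF m] by auto
    from zclosureD[OF this slicesI[OF m, of q a] fA] have "q (a(m := a m)) = 0" .
    then show ?case by simp
  qed
  from this[of k a] a show ?thesis by simp
qed

lemma slices_subset_box_poly:
  assumes "q \<in> sep k (poly_fun {..<n})"
  shows "\<exists>d. slices k q \<subseteq> box_poly n d"
proof -
  obtain T where T: "T \<subseteq> poly_fun {..<n}" "finite T" "slices k q \<subseteq> fspan T"
    using slices_subset_fspan[OF assms] by blast
  have "\<forall>t\<in>T. \<exists>d. t \<in> box_poly n d" using T(1) poly_fun_imp_box_poly by blast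
  from bchoice[OF this] obtain d where d: "\<And>t. t \<in> T \<Longrightarrow> t \<in> box_poly n (d t)" by blast
  have "T \<subseteq> box_poly n (sum d T)"
  proof
    fix t assume t: "t \<in> T"
    then have "d t \<le> sum d T" using T(2) by (simp add: member_le_sum)
    then show "t \<in> box_poly n (sum d T)" using d[OF t] box_poly_mono by blast
  qed
  then have "fspan T \<subseteq> box_poly n (sum d T)"
    unfolding box_poly_def by (rule fspan_subset_fspan)
  then show ?thesis using T(3) by blast
qed

lemma box_poly_common_zeros_dichotomy:
  assumes H: "H \<subseteq> box_poly n d"
  defines "V \<equiv> {x \<in> Rn n. \<forall>f\<in>H. f x = 0}"
  shows "finite V \<and> card V \<le> ((n * (d + d) + 1) ^ n) ^ n \<or> (UNIV::real set) \<lesssim> V"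
proof -
  obtain F where F: "F \<subseteq> H" "finite F" "{x \<in> Rn n. \<forall>f\<in>F. f x = 0} = V"
    using ex_finite_common_zeros[OF finite_box_mono H[unfolded box_poly_def], of "Rn n"]
    unfolding V_def by blast
  let ?s = "\<lambda>x. \<Sum>f\<in>F. f x * f x"
  have s: "?s \<in> box_poly n (d + d)"
    using F(1) H by (intro box_poly_sum box_poly_mult) auto
  have "V = {x \<in> Rn n. ?s x = 0}"
    unfolding F(3)[symmetric] using F(2) by (simp add: sum_nonneg_eq_0_iff)
  then show ?thesis using zero_set_card_dichotomy[OF s] by (simp add: sum_nonneg)
qed

lemma product_zero_dichotomy:
  assumes q: "q \<in> sep k (poly_fun {..<n})"
  shows "\<exists>N. \<forall>A\<subseteq>Rn n. (\<forall>a. (\<forall>i<k. a i \<in> A) \<longrightarrow> q a = 0) \<longrightarrow>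
    (finite A \<and> card A \<le> N) \<or>
    (\<exists>V\<subseteq>Rn n. (UNIV::real set) \<lesssim> V \<and> (\<forall>a. (\<forall>i<k. a i \<in> V) \<longrightarrow> q a = 0))"
proof -
  obtain d where d: "slices k q \<subseteq> box_poly n d" using slices_subset_box_poly[OF q] by blast
  let ?N = "((n * (d + d) + 1) ^ n) ^ n"
  have "(finite A \<and> card A \<le> ?N) \<or>
    (\<exists>V\<subseteq>Rn n. (UNIV::real set) \<lesssim> V \<and> (\<forall>a. (\<forall>i<k. a i \<in> V) \<longrightarrow> q a = 0))"
    if A: "A \<subseteq> Rn n" and zero: "\<And>a. (\<And>i. i < k \<Longrightarrow> a i \<in> A) \<Longrightarrow> q a = 0" for A
  proof -
    define H where "H = {f \<in> slices k q. \<forall>x\<in>A. f x = 0}"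
    define V where "V = {x \<in> Rn n. \<forall>f\<in>H. f x = 0}"
    have "A \<subseteq> V" using A by (auto simp: V_def H_def)
    have "V \<subseteq> zclosure (slices k q) A" by (auto simp: V_def H_def zclosure_def)
    then have V0: "\<forall>a. (\<forall>i<k. a i \<in> V) \<longrightarrow> q a = 0"
      using zclosure_product_zero[of k "\<lambda>i. A" q "\<lambda>i. V"] zero by blast
    have "H \<subseteq> box_poly n d" using d by (auto simp: H_def)
    from box_poly_common_zeros_dichotomy[OF this]
    consider "finite V" "card V \<le> ?N" | "(UNIV::real set) \<lesssim> V" unfolding V_def by blast
    then show ?thesis
    proof cases
      case 1
      have "finite A" "card A \<le> card V"
        using \<open>A \<subseteq> V\<close> 1(1) by (auto intro: finite_subset card_mono)
      then show ?thesis using 1(2) by auto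
    next
      case 2
      have "V \<subseteq> Rn n" by (auto simp: V_def)
      then show ?thesis using 2 V0 by blast
    qed
  qed
  then show ?thesis by (intro exI[of _ ?N]) blast
qed

text \<open>Removing \<open>k\<close> disjoint successive bases for the slices turns vanishing on injective tuples into
  vanishing on all tuples: an injective tuple with entries in the bases can be moved, one coordinate
  at a time, to an arbitrary tuple of remaining points.\<close>
lemma ex_small_exceptional_set:
  assumes q: "q \<in> sep k G"
  shows "\<exists>D. \<forall>X. (\<forall>a. inj_on a {..<k} \<and> a ` {..<k} \<subseteq> X \<longrightarrow> q a = 0) \<longrightarrow>
    (\<exists>F\<subseteq>X. finite F \<and> card F \<le> D \<and> (\<forall>a. (\<forall>i<k. a i \<in> X - F) \<longrightarrow> q a = 0))"
proof -
  obtain T where T: "finite T" "slices k q \<subseteq> fspan T" using slices_subset_fspan[OF q] by blast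
  have "\<forall>A. \<exists>F. F \<subseteq> A \<and> finite F \<and> card F \<le> card T \<and> A \<subseteq> zclosure (slices k q) F"
    using ex_finite_zclosure_basis[OF T] by blast
  from choice[OF this] obtain B where B: "\<And>A. B A \<subseteq> A" "\<And>A. finite (B A)" "\<And>A. card (B A) \<le> card T"
    "\<And>A. A \<subseteq> zclosure (slices k q) (B A)" by blast
  have ex: "\<exists>F\<subseteq>X. finite F \<and> card F \<le> k * card T \<and> (\<forall>a. (\<forall>i<k. a i \<in> X - F) \<longrightarrow> q a = 0)"
    if X: "\<And>a. inj_on a {..<k} \<Longrightarrow> a ` {..<k} \<subseteq> X \<Longrightarrow> q a = 0" for X
  proof -
    define U where "U = rec_nat {} (\<lambda>m U. U \<union> B (X - U))"
    have U: "U 0 = {}" "\<And>m. U (Suc m) = U m \<union> B (X - U m)" by (simp_all add: U_def)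
    have Umono: "U i \<subseteq> U j" if "i \<le> j" for i j
      using that by (rule lift_Suc_mono_le[of U, rotated]) (simp add: U)
    have "U m \<subseteq> X \<and> finite (U m) \<and> card (U m) \<le> m * card T" for m
    proof (induction m)
      case (Suc m)
      have "card (U (Suc m)) \<le> card (U m) + card (B (X - U m))" unfolding U by (rule card_Un_le)
      then show ?case using Suc B(1)[of "X - U m"] B(2,3)[of "X - U m"] by (auto simp: U)
    qed (simp add: U)
    then have Uk: "U k \<subseteq> X" "finite (U k)" "card (U k) \<le> k * card T" by auto
    have disj: "B (X - U i) \<inter> B (X - U j) = {}" if "i < j" for i j
      using Umono[of "Suc i" j] that B(1)[of "X - U j"] by (auto simp: U)
    have "q a = 0" if a: "\<And>i. i < k \<Longrightarrow> a i \<in> X - U k" for a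
    proof (rule zclosure_product_zero[where A = "\<lambda>i. B (X - U i)" and B = "\<lambda>i. X - U k"])
      fix b assume b: "\<And>i. i < k \<Longrightarrow> b i \<in> B (X - U i)"
      have "b i \<noteq> b j" if "i < j" "j < k" for i j
        using b[of i] b[of j] disj[OF that(1)] that by auto
      then have "inj_on b {..<k}" by (intro linorder_inj_onI) auto
      moreover have "b ` {..<k} \<subseteq> X" using b B(1) by blast
      ultimately show "q b = 0" by (rule X)
    next
      fix i assume "i < k"
      then have "X - U k \<subseteq> X - U i" using Umono[of i k] by auto
      then show "X - U k \<subseteq> zclosure (slices k q) (B (X - U i))" using B(4)[of "X - U i"] by blast
    qed (rule a)
    then show ?thesis using Uk by (intro exI[of _ "U k"]) blast
  qed
  show ?thesis
  proof (intro exI[of _ "k * card T"] allI impI)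
    fix X assume "\<forall>a. inj_on a {..<k} \<and> a ` {..<k} \<subseteq> X \<longrightarrow> q a = 0"
    then show "\<exists>F\<subseteq>X. finite F \<and> card F \<le> k * card T \<and> (\<forall>a. (\<forall>i<k. a i \<in> X - F) \<longrightarrow> q a = 0)"
      by (intro ex) simp
  qed
qed

lemma poly_fun_imp_sep:
  assumes p: "p \<in> poly_fun ({..<k} \<times> {..<n})" and k: "0 < k"
  shows "(\<lambda>a. p (\<lambda>(i, j). a i j)) \<in> sep k (poly_fun {..<n})"
  using p
proof induction
  case (const c)
  show ?case using sep_coord[OF poly_fun.const k poly_fun.const] .
next
  case (var v)
  then obtain i j where v: "v = (i, j)" "i < k" "j < n" by auto
  then show ?case using sep_coord[OF poly_fun.const v(2) poly_fun.var[of j "{..<n}"]] by simp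
next
  case (add p q)
  show ?case using add.IH by (rule sep_add)
next
  case (mult p q)
  show ?case using sep_mult[OF poly_fun.mult mult.IH] .
qed

lemma algebraic_hypergraph_sep:
  assumes k: "0 < k" and E: "algebraic_hypergraph n k E"
  shows "\<exists>q\<in>sep k (poly_fun {..<n}). \<forall>a. inj_on a {..<k} \<and> a ` {..<k} \<subseteq> Rn n \<longrightarrow>
    (a ` {..<k} \<in> E \<longleftrightarrow> q a = 0)"
proof -
  obtain p where p: "p \<in> poly_fun ({..<k} \<times> {..<n})" "E = poly_edges n k p"
    using E by (auto simp: algebraic_hypergraph_def)
  define q0 where "q0 a = p (\<lambda>(i, j). a i j)" for a
  have q0: "q0 \<in> sep k (poly_fun {..<n})" unfolding q0_def using poly_fun_imp_sep[OF p(1) k] .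
  define q where "q a = (\<Prod>\<sigma>\<in>{\<sigma>. \<sigma> permutes {..<k}}. q0 (\<lambda>i. a (\<sigma> i)))" for a
  have "(\<lambda>a. q0 (\<lambda>i. a (\<sigma> i))) \<in> sep k (poly_fun {..<n})" if "\<sigma> permutes {..<k}" for \<sigma>
    by (rule sep_reindex[where c = "\<lambda>x i. x", OF poly_fun.mult poly_fun.const _ _ q0])
      (use permutes_in_image[OF that] in simp_all)
  then have "q \<in> sep k (poly_fun {..<n})"
    unfolding q_def by (intro sep_finite_prod poly_fun.mult poly_fun.const k) auto
  moreover have "a ` {..<k} \<in> E \<longleftrightarrow> q a = 0" if a: "inj_on a {..<k}" "a ` {..<k} \<subseteq> Rn n" for a
  proof -
    have "q a = 0 \<longleftrightarrow> (\<exists>\<sigma>. \<sigma> permutes {..<k} \<and> q0 (\<lambda>i. a (\<sigma> i)) = 0)"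
      unfolding q_def by (simp add: finite_permutations)
    also have "\<dots> \<longleftrightarrow> (\<exists>b. bij_betw b {..<k} (a ` {..<k}) \<and> q0 b = 0)"
    proof
      assume "\<exists>\<sigma>. \<sigma> permutes {..<k} \<and> q0 (\<lambda>i. a (\<sigma> i)) = 0"
      then obtain \<sigma> where \<sigma>: "\<sigma> permutes {..<k}" "q0 (\<lambda>i. a (\<sigma> i)) = 0" by blast
      have "bij_betw (a \<circ> \<sigma>) {..<k} (a ` {..<k})"
        using permutes_imp_bij[OF \<sigma>(1)] inj_on_imp_bij_betw[OF a(1)] by (rule bij_betw_trans)
      then show "\<exists>b. bij_betw b {..<k} (a ` {..<k}) \<and> q0 b = 0" using \<sigma>(2) by (auto simp: comp_def)
    next
      assume "\<exists>b. bij_betw b {..<k} (a ` {..<k}) \<and> q0 b = 0"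
      then obtain b where b: "bij_betw b {..<k} (a ` {..<k})" "q0 b = 0" by blast
      define \<sigma> where "\<sigma> i = (if i < k then inv_into {..<k} a (b i) else i)" for i
      have bim: "b i \<in> a ` {..<k}" if "i < k" for i using bij_betwE[OF b(1)] that by simp
      have "bij_betw (inv_into {..<k} a \<circ> b) {..<k} {..<k}"
        using b(1) bij_betw_inv_into[OF inj_on_imp_bij_betw[OF a(1)]] by (rule bij_betw_trans)
      then have "bij_betw \<sigma> {..<k} {..<k}" by (subst bij_betw_cong[of _ _ "inv_into {..<k} a \<circ> b"]) (auto simp: \<sigma>_def)
      then have "\<sigma> permutes {..<k}" by (rule bij_imp_permutes) (simp add: \<sigma>_def)
      moreover have "q0 (\<lambda>i. a (\<sigma> i)) = q0 b"
        by (rule sep_cong[OF q0]) (simp add: \<sigma>_def f_inv_into_f[OF bim])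
      ultimately show "\<exists>\<sigma>. \<sigma> permutes {..<k} \<and> q0 (\<lambda>i. a (\<sigma> i)) = 0" using b(2) by auto
    qed
    also have "\<dots> \<longleftrightarrow> a ` {..<k} \<in> E"
      using a unfolding p(2) poly_edges_def ksubsets_def q0_def by (simp add: card_image)
    finally show ?thesis by simp
  qed
  ultimately show ?thesis by blast
qed

lemma ksubsetsE:
  assumes "e \<in> ksubsets X k"
  obtains a where "inj_on a {..<k}" "a ` {..<k} = e" "e \<subseteq> X"
proof -
  have e: "finite e" "card e = k" "e \<subseteq> X" using assms by (auto simp: ksubsets_def)
  obtain a where "bij_betw a {..<k} e" using ex_bij_betw_nat_finite[OF e(1)] e(2) by (auto simp: atLeast0LessThan)
  then show ?thesis using that e(3) by (auto simp: bij_betw_def)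
qed

theorem theorem2:
  fixes n k :: nat and E :: "(nat \<Rightarrow> real) set set"
  assumes "2 \<le> k" and "algebraic_hypergraph n k E"
  shows "((\<exists>m::nat. \<forall>X \<subseteq> Rn n. complete k E X \<longrightarrow> finite X \<and> card X < m)
          \<longleftrightarrow> (\<forall>X \<subseteq> Rn n. complete k E X \<longrightarrow> X \<prec> (UNIV :: real set)))
       \<and> ((\<forall>X \<subseteq> Rn n. complete k E X \<longrightarrow> X \<prec> (UNIV :: real set))
          \<longleftrightarrow> (\<forall>X \<subseteq> Rn n. infinite X \<longrightarrow>
                 (\<exists>Y \<subseteq> X. independent k E Y \<and> Y \<approx> X)))"
proof -
  let ?one = "\<exists>m::nat. \<forall>X \<subseteq> Rn n. complete k E X \<longrightarrow> finite X \<and> card X < m"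
  let ?two = "\<forall>X \<subseteq> Rn n. complete k E X \<longrightarrow> X \<prec> (UNIV :: real set)"
  let ?three = "\<forall>X \<subseteq> Rn n. infinite X \<longrightarrow> (\<exists>Y \<subseteq> X. independent k E Y \<and> Y \<approx> X)"
  have k: "0 < k" using assms(1) by simp
  obtain q where q: "q \<in> sep k (poly_fun {..<n})" and
    edge: "\<And>a. inj_on a {..<k} \<Longrightarrow> a ` {..<k} \<subseteq> Rn n \<Longrightarrow> a ` {..<k} \<in> E \<longleftrightarrow> q a = 0"
    using algebraic_hypergraph_sep[OF k assms(2)] by blast
  have zero: "q a = 0" if X: "X \<subseteq> Rn n" "complete k E X" and a: "inj_on a {..<k}" "a ` {..<k} \<subseteq> X" for X a
  proof -
    have "a ` {..<k} \<in> ksubsets X k" using a by (simp add: ksubsets_def card_image)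
    then have "a ` {..<k} \<in> E" using X(2) by (auto simp: complete_def)
    then show ?thesis using edge[OF a(1)] a(2) X(1) by blast
  qed
  have finite_less: "X \<prec> (UNIV :: real set)" if "finite X" for X :: "(nat \<Rightarrow> real) set"
    using that by (intro finite_lesspoll_infinite infinite_UNIV_char_0)
  have bounded: "\<exists>N. \<forall>A\<subseteq>Rn n. (\<forall>a. (\<forall>i<k. a i \<in> A) \<longrightarrow> q a = 0) \<longrightarrow> finite A \<and> card A \<le> N"
    if two: ?two
  proof -
    have "\<not> (UNIV::real set) \<lesssim> V" if V: "V \<subseteq> Rn n" "\<And>a. (\<And>i. i < k \<Longrightarrow> a i \<in> V) \<Longrightarrow> q a = 0" for V
    proof
      assume "(UNIV::real set) \<lesssim> V"
      have "complete k E V"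
        unfolding complete_def
      proof
        fix e assume "e \<in> ksubsets V k"
        then obtain a where a: "inj_on a {..<k}" "a ` {..<k} = e" "e \<subseteq> V" by (rule ksubsetsE)
        then have "q a = 0" by (intro V(2)) auto
        then show "e \<in> E" using edge[OF a(1)] a(2,3) V(1) by blast
      qed
      then have "V \<prec> (UNIV::real set)" using two V(1) by blast
      then have "V \<prec> V" using \<open>UNIV \<lesssim> V\<close> by (rule lesspoll_trans2)
      then show False using lesspoll_not_refl by blast
    qed
    then have noV: "\<not> (\<exists>V\<subseteq>Rn n. (UNIV::real set) \<lesssim> V \<and> (\<forall>a. (\<forall>i<k. a i \<in> V) \<longrightarrow> q a = 0))" by blast
    show ?thesis using product_zero_dichotomy[OF q] by (simp only: noV simp_thms)
  qed
  have "?one \<Longrightarrow> ?two" using finite_less by blast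
  moreover have ?one if two: ?two
  proof -
    from bounded[OF two] obtain N where
      N: "\<forall>A\<subseteq>Rn n. (\<forall>a. (\<forall>i<k. a i \<in> A) \<longrightarrow> q a = 0) \<longrightarrow> finite A \<and> card A \<le> N" ..
    from ex_small_exceptional_set[OF q] obtain D where
      D: "\<forall>X. (\<forall>a. inj_on a {..<k} \<and> a ` {..<k} \<subseteq> X \<longrightarrow> q a = 0) \<longrightarrow>
        (\<exists>F\<subseteq>X. finite F \<and> card F \<le> D \<and> (\<forall>a. (\<forall>i<k. a i \<in> X - F) \<longrightarrow> q a = 0))" ..
    have "finite X \<and> card X < Suc (N + D)" if X: "X \<subseteq> Rn n" "complete k E X" for X
    proof -
      have "\<exists>F\<subseteq>X. finite F \<and> card F \<le> D \<and> (\<forall>a. (\<forall>i<k. a i \<in> X - F) \<longrightarrow> q a = 0)"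
        by (rule D[rule_format]) (use zero[OF X] in blast)
      then obtain F where F: "F \<subseteq> X" "finite F" "card F \<le> D"
        and F0: "\<forall>a. (\<forall>i<k. a i \<in> X - F) \<longrightarrow> q a = 0" by (elim exE conjE) (rule that)
      have "finite (X - F) \<and> card (X - F) \<le> N" using X(1) F0 by (intro N[rule_format]) auto
      then have XF: "finite (X - F)" "card (X - F) \<le> N" by auto
      have "finite X" using F(2) XF(1) by simp
      moreover have "card X = card (X - F) + card F"
        using F(1,2) \<open>finite X\<close> card_mono[of X F] by (simp add: card_Diff_subset)
      ultimately show ?thesis using XF(2) F(3) by simp
    qed
    then show ?thesis by blast
  qed
  moreover have ?three if two: ?two
  proof (intro allI impI)
    fix X assume X: "X \<subseteq> Rn n" "infinite X"
    have "\<exists>a. (\<forall>i<k. a i \<in> A) \<and> q a \<noteq> 0" if "A \<subseteq> X" "infinite A" for A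
      using bounded[OF two] that X(1) by blast
    then obtain Y where Y: "Y \<subseteq> X" "|X| \<le>o |Y|" "\<And>a. inj_on a {..<k} \<Longrightarrow> a ` {..<k} \<subseteq> Y \<Longrightarrow> q a \<noteq> 0"
      using large_generic_subset[OF q k X(2)] by blast
    have "X \<lesssim> Y" using Y(2) unfolding lepoll_def card_of_ordLeq .
    then have "Y \<approx> X" using Y(1) by (intro lepoll_antisym[OF subset_imp_lepoll])
    moreover have "independent k E Y"
      unfolding independent_def
    proof (rule ccontr)
      assume "ksubsets Y k \<inter> E \<noteq> {}"
      then obtain e where e: "e \<in> ksubsets Y k" "e \<in> E" by blast
      obtain a where a: "inj_on a {..<k}" "a ` {..<k} = e" "e \<subseteq> Y" by (rule ksubsetsE[OF e(1)]) (rule that)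
      then show False using edge[OF a(1)] Y(3)[OF a(1)] e(2) Y(1) X(1) by blast
    qed
    ultimately show "\<exists>Y\<subseteq>X. independent k E Y \<and> Y \<approx> X" using Y(1) by blast
  qed
  moreover have ?two if three: ?three
  proof (intro allI impI)
    fix X assume X: "X \<subseteq> Rn n" "complete k E X"
    have "finite X"
    proof (rule ccontr)
      assume "infinite X"
      then obtain Y where Y: "Y \<subseteq> X" "independent k E Y" "Y \<approx> X" using three X(1) by blast
      have "infinite Y" using eqpoll_finite_iff[OF Y(3)] \<open>infinite X\<close> by simp
      then obtain e where "finite e" "card e = k" "e \<subseteq> Y" using infinite_arbitrarily_large by blast
      then have "e \<in> ksubsets Y k" "e \<in> ksubsets X k" using Y(1) by (auto simp: ksubsets_def)
      then show False using X(2) Y(2) unfolding complete_def independent_def by blast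
    qed
    then show "X \<prec> (UNIV :: real set)" by (rule finite_less)
  qed
  ultimately show ?thesis by blast
qed


end
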